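(* Let $M$ be a compact smooth manifold and let $\rho_0$ be any $C^1$-action of a countable group $\Gamma$ on $M$ (an action by $C^1$-diffeomorphisms). If $\rho_0(\Gamma)$ has a dense orbit in $M$, then there exists a $C^0$-action $\rho$ of $\Gamma$ on $M$ (an action by homeomorphisms) that is not $C^0$-conjugate to $\rho_0$. Moreover, $\rho$ can be chosen to be arbitrarily $C^0$-close to $\rho_0$.
   Context: Two actions $\rho,\rho_0:\Gamma\to\mathrm{Homeo}(M)$ are $C^0$-conjugate if there is a homeomorphism $h$ of $M$ with $h\circ\rho(\gamma)=\rho_0(\gamma)\circ h$ for all $\gamma\in\Gamma$. The space of actions carries the topology induced by the compact-open topology on $\mathrm{Homeo}(M)$: "arbitrarily $C^0$-close" means that $\rho$ can be chosen in any prescribed neighborhood of $\rho_0$ in this topology of convergence of $\rho(\gamma)$ to $\rho_0(\gamma)$, uniformly on $M$, for each $\gamma\in\Gamma$.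
   Formalization: The manifold is taken to have dimension at least 1; in dimension 0 the claim fails, for example when M is a single point, where the only action is the trivial one, so every action is conjugate to the given one. *)

theory Defs
  imports "HOL-Analysis.Analysis" "HOL-Algebra.Group_Action"
begin

text \<open>
  Only meant for open \<^term>\<open>S\<close>. On an open subset of a Euclidean space, continuity of all
  directional derivatives of a differentiable map is continuity of the derivative, so
  \<^term>\<open>C_on k f S\<close> is the usual notion of a \<open>C\<^sup>k\<close> map.
\<close>

primrec C_on :: "nat \<Rightarrow> ('e::euclidean_space \<Rightarrow> 'f::euclidean_space) \<Rightarrow> 'e set \<Rightarrow> bool" where
  "C_on 0 f S \<longleftrightarrow> continuous_on S f"
| "C_on (Suc k) f S \<longleftrightarrow>
     (\<forall>x\<in>S. f differentiable (at x)) \<and>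
     (\<forall>v. C_on k (\<lambda>x. frechet_derivative f (at x) v) S)"

definition smooth_on_open :: "('e::euclidean_space \<Rightarrow> 'f::euclidean_space) \<Rightarrow> 'e set \<Rightarrow> bool" where
  "smooth_on_open f S \<longleftrightarrow> (\<forall>k. C_on k f S)"

type_synonym ('m, 'e) chart = "'m set \<times> ('m \<Rightarrow> 'e)"

definition is_chart :: "'m topology \<Rightarrow> ('m, 'e::euclidean_space) chart \<Rightarrow> bool" where
  "is_chart M c \<longleftrightarrow> (case c of (U, \<phi>) \<Rightarrow>
     openin M U \<and> open (\<phi> ` U) \<and>
     homeomorphic_map (subtopology M U) (top_of_set (\<phi> ` U)) \<phi>)"

text \<open>
  A smooth manifold without boundary, given by a smooth atlas that need not be maximal. The
  dimension is \<open>DIM('e)\<close>, which is always at least 1.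
\<close>

definition smooth_manifold :: "'m topology \<Rightarrow> ('m, 'e::euclidean_space) chart set \<Rightarrow> bool" where
  "smooth_manifold M A \<longleftrightarrow>
     Hausdorff_space M \<and> second_countable M \<and>
     (\<forall>c\<in>A. is_chart M c) \<and>
     (\<Union>c\<in>A. fst c) = topspace M \<and>
     (\<forall>(U, \<phi>)\<in>A. \<forall>(V, \<psi>)\<in>A. smooth_on_open (\<psi> \<circ> inv_into U \<phi>) (\<phi> ` (U \<inter> V)))"

definition C1_map ::
    "'m topology \<Rightarrow> ('m, 'e::euclidean_space) chart set \<Rightarrow> ('m \<Rightarrow> 'm) \<Rightarrow> bool" where
  "C1_map M A f \<longleftrightarrow>
     continuous_map M M f \<and>
     (\<forall>(U, \<phi>)\<in>A. \<forall>(V, \<psi>)\<in>A. C_on 1 (\<psi> \<circ> f \<circ> inv_into U \<phi>) (\<phi> ` {x \<in> U. f x \<in> V}))"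

definition C1_diffeo ::
    "'m topology \<Rightarrow> ('m, 'e::euclidean_space) chart set \<Rightarrow> ('m \<Rightarrow> 'm) \<Rightarrow> bool" where
  "C1_diffeo M A f \<longleftrightarrow>
     bij_betw f (topspace M) (topspace M) \<and> C1_map M A f \<and> C1_map M A (inv_into (topspace M) f)"

text \<open>
  As in \<^const>\<open>BijGroup\<close>, self-homeomorphisms are represented by functions that are
  \<^const>\<open>undefined\<close> outside the space, so that distinct representatives are distinct maps.
\<close>

definition Homeo :: "'m topology \<Rightarrow> ('m \<Rightarrow> 'm) set" where
  "Homeo M = {f \<in> extensional (topspace M). homeomorphic_map M M f}"

definition compact_open_topology :: "'m topology \<Rightarrow> ('m \<Rightarrow> 'm) topology" where
  "compact_open_topology M =
     topology_generated_by {{f \<in> Homeo M. f ` K \<subseteq> U} |K U. compactin M K \<and> openin M U}"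

text \<open>Extensionality in the group argument matches the points of \<^const>\<open>product_topology\<close>.\<close>

definition C0_actions :: "('g, 'b) monoid_scheme \<Rightarrow> 'm topology \<Rightarrow> ('g \<Rightarrow> 'm \<Rightarrow> 'm) set" where
  "C0_actions G M =
     {\<rho> \<in> carrier G \<rightarrow>\<^sub>E Homeo M. group_action G (topspace M) \<rho>}"

definition C1_actions ::
    "('g, 'b) monoid_scheme \<Rightarrow> 'm topology \<Rightarrow> ('m, 'e::euclidean_space) chart set
      \<Rightarrow> ('g \<Rightarrow> 'm \<Rightarrow> 'm) set" where
  "C1_actions G M A = {\<rho> \<in> C0_actions G M. \<forall>g\<in>carrier G. C1_diffeo M A (\<rho> g)}"

definition action_topology ::
    "('g, 'b) monoid_scheme \<Rightarrow> 'm topology \<Rightarrow> ('g \<Rightarrow> 'm \<Rightarrow> 'm) topology" where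
  "action_topology G M =
     subtopology (product_topology (\<lambda>_. compact_open_topology M) (carrier G)) (C0_actions G M)"

definition C0_conjugate ::
    "('g, 'b) monoid_scheme \<Rightarrow> 'm topology \<Rightarrow> ('g \<Rightarrow> 'm \<Rightarrow> 'm) \<Rightarrow> ('g \<Rightarrow> 'm \<Rightarrow> 'm) \<Rightarrow> bool" where
  "C0_conjugate G M \<rho> \<rho>\<^sub>0 \<longleftrightarrow>
     (\<exists>h\<in>Homeo M. \<forall>g\<in>carrier G. \<forall>x\<in>topspace M. h (\<rho> g x) = \<rho>\<^sub>0 g (h x))"

definition has_dense_orbit ::
    "('g, 'b) monoid_scheme \<Rightarrow> 'm topology \<Rightarrow> ('g \<Rightarrow> 'm \<Rightarrow> 'm) \<Rightarrow> bool" where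
  "has_dense_orbit G M \<rho> \<longleftrightarrow>
     (\<exists>x\<in>topspace M. M closure_of (orbit G \<rho> x) = topspace M)"

lemma topspace_compact_open_topology: "topspace (compact_open_topology M) = Homeo M"
proof -
  have "{f \<in> Homeo M. f ` {} \<subseteq> topspace M} \<in>
      {{f \<in> Homeo M. f ` K \<subseteq> U} |K U. compactin M K \<and> openin M U}"
    by (intro CollectI exI[of _ "{}"] exI[of _ "topspace M"]) auto
  then show ?thesis
    unfolding compact_open_topology_def topology_generated_by_topspace by auto
qed

lemma topspace_action_topology: "topspace (action_topology G M) = C0_actions G M"
  by (auto simp: action_topology_def C0_actions_def topspace_compact_open_topology)

end

theory Submission
  imports Defs
begin

text \<open>
  By Baire's theorem there is a point \<open>y\<close> such that every group element fixing \<open>y\<close> is the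
  identity near \<open>y\<close>. Hence a chart at \<open>y\<close> can be transported unambiguously, as a germ, to
  every point of the orbit of \<open>y\<close>, and replacing each orbit point by a closed ball glued in
  along the directions of these charts gives a compact space \<open>X\<close> to which the action lifts,
  with stabilizers acting trivially on the balls. The projection of \<open>X\<close> to \<open>M\<close> is a uniform limit
  of homeomorphisms (Bing shrinking, one ball at a time), so the lifted action is carried to an
  action on \<open>M\<close> close to the given one. It has no dense orbit, since an orbit meets each ball in
  at most one interior point.
\<close>

section \<open>Metrizability and limits of almost injective maps\<close>

text \<open>Two group elements taking \<open>y\<close> to the same point \<open>p\<close> differ by
  a stabilizer element, and the directions they induce at \<open>p\<close> must coincide if a ball
  is to be glued in equivariantly; this is what the choice of \<open>y\<close> secures. Full balls,
  not just spheres of directions, are inserted so that the result is again homeomorphic to the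
  original space. The orbit may be dense, so the balls cannot be glued in inside disjoint charts.
  The blow-up is therefore cut out by closed equations in the product of the space with one
  Euclidean coordinate per orbit point, and continuity of the lifted action is checked coordinate by
  coordinate. Its homeomorphism with the original space has no formula and exists only as a limit.
  The projection intertwines the lifted action with the given one exactly, so conjugating by a
  homeomorphism uniformly near the projection changes each group element only a little. Having a
  dense orbit is a conjugacy invariant, which is how the two actions are told apart.\<close>

lemma compact_Hausdorff_second_countable_imp_metrizable:
  assumes comp: "compact_space X" and haus: "Hausdorff_space X" and sc: "second_countable X"
  shows "metrizable_space X"
proof -
  obtain \<B> where \<B>: "countable \<B>" "\<And>V. V \<in> \<B> \<Longrightarrow> openin X V"
    "\<And>U x. openin X U \<Longrightarrow> x \<in> U \<Longrightarrow> \<exists>V\<in>\<B>. x \<in> V \<and> V \<subseteq> U"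
    using sc unfolding second_countable_def by metis
  have norm: "normal_space X"
    using comp haus compact_Hausdorff_or_regular_imp_normal_space by blast
  \<comment> \<open>Urysohn's metrization argument: one separating function for each nested pair of
    basic sets. There are only countably many, so the product receiving the embedding is
    metrizable.\<close>
  define I where "I = {(U, V). U \<in> \<B> \<and> V \<in> \<B> \<and> X closure_of U \<subseteq> V}"
  have cI: "countable I"
    by (rule countable_subset[of _ "\<B> \<times> \<B>"]) (auto simp: I_def \<B>)
  have "\<exists>f. continuous_map X euclideanreal f \<and> f ` (X closure_of U) \<subseteq> {0}
      \<and> f ` (topspace X - V) \<subseteq> {1}" if UV: "(U, V) \<in> I" for U V
  proof -
    have "closedin X (topspace X - V)" "disjnt (X closure_of U) (topspace X - V)"
      using UV \<B>(2) by (auto simp: I_def disjnt_def)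
    then show ?thesis
      using Urysohn_lemma_alt[OF norm closedin_closure_of] by metis
  qed
  then have "\<forall>i\<in>I. \<exists>f. continuous_map X euclideanreal f \<and> f ` (X closure_of fst i) \<subseteq> {0}
      \<and> f ` (topspace X - snd i) \<subseteq> {1}" by auto
  from bchoice[OF this] obtain f where "\<forall>i\<in>I. continuous_map X euclideanreal (f i) \<and>
      f i ` (X closure_of fst i) \<subseteq> {0} \<and> f i ` (topspace X - snd i) \<subseteq> {1}" ..
  then have f: "\<And>i. i \<in> I \<Longrightarrow> continuous_map X euclideanreal (f i)"
    "\<And>i. i \<in> I \<Longrightarrow> f i ` (X closure_of fst i) \<subseteq> {0}"
    "\<And>i. i \<in> I \<Longrightarrow> f i ` (topspace X - snd i) \<subseteq> {1}" by blast+
  define F where "F x = (\<lambda>i\<in>I. f i x)" for x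
  let ?P = "product_topology (\<lambda>_. euclideanreal) I"
  have contF: "continuous_map X ?P F"
    unfolding F_def continuous_map_componentwise using f(1) by (auto cong: restrict_cong)
  have inj: "inj_on F (topspace X)"
  proof (rule inj_onI, rule ccontr)
    fix x y assume xy: "x \<in> topspace X" "y \<in> topspace X" "F x = F y" "x \<noteq> y"
    have t1: "openin X (topspace X - {y})"
      by (metis closedin_def closedin_Hausdorff_singleton haus xy(2))
    then obtain V where V: "V \<in> \<B>" "x \<in> V" "V \<subseteq> topspace X - {y}" using \<B>(3) xy by blast
    have "regular_space X"
      using haus comp compact_Hausdorff_imp_regular_space by blast
    moreover have "closedin X (topspace X - V)" "x \<in> topspace X - (topspace X - V)"
      using V \<B>(2) xy(1) by auto
    ultimately obtain W where W: "openin X W" "x \<in> W" "disjnt (topspace X - V) (X closure_of W)"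
      unfolding regular_space by metis
    then have W': "X closure_of W \<subseteq> V"
      using closure_of_subset_topspace[of X W] unfolding disjnt_def by blast
    obtain U where U: "U \<in> \<B>" "x \<in> U" "U \<subseteq> W" using \<B>(3) W by blast
    have UV: "(U, V) \<in> I" using U V W' closure_of_mono[of U W X] by (auto simp: I_def)
    have "x \<in> X closure_of U"
      using closure_of_subset[OF openin_subset[OF \<B>(2)[OF U(1)]]] U(2) by blast
    then have "f (U, V) x = 0" using f(2)[OF UV] by auto
    moreover have "f (U, V) y = 1" using f(3)[OF UV] V xy by auto
    moreover have "f (U, V) x = f (U, V) y"
      using fun_cong[OF xy(3), of "(U, V)"] UV by (simp add: F_def)
    ultimately show False by simp
  qed
  have hP: "Hausdorff_space ?P" by (simp add: Hausdorff_space_product_topology)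
  have "embedding_map X ?P F"
    using continuous_imp_closed_map_gen[OF comp Hausdorff_imp_kc_space[OF hP] contF]
    by (intro injective_closed_imp_embedding_map contF inj)
  then have "X homeomorphic_space subtopology ?P (F ` topspace X)"
    using embedding_map_imp_homeomorphic_space by blast
  moreover have "metrizable_space ?P"
    unfolding metrizable_space_product_topology
    using countable_subset[OF _ cI] metrizable_space_euclidean by auto
  ultimately show ?thesis
    by (metis homeomorphic_metrizable_space metrizable_space_subtopology)
qed

text \<open>
  Bing's shrinking argument: \<open>f\<^sub>n\<^sub>+\<^sub>1\<close> is taken closer to \<open>f\<^sub>n\<close> than the distance by which
  \<open>f\<^sub>0, \<dots>, f\<^sub>n\<close> separate the pairs in \<open>K 0, \<dots>, K n\<close>, so the limit still separates them.
\<close>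

lemma (in Metric_space) homeomorphic_map_limit:
  assumes X: "compact_space X" and M: "compact_space mtopology"
    and K: "\<And>n. compactin (prod_topology X X) (K n)"
      "\<And>a b. a \<in> topspace X \<Longrightarrow> b \<in> topspace X \<Longrightarrow> a \<noteq> b \<Longrightarrow> \<exists>n. (a, b) \<in> K n"
    and P0: "P 0 f0"
    and cont: "\<And>n f. P n f \<Longrightarrow> continuous_map X mtopology f"
    and surj: "\<And>n f. P n f \<Longrightarrow> f ` topspace X = M"
    and sep: "\<And>n f a b. P n f \<Longrightarrow> (a, b) \<in> K n \<Longrightarrow> f a \<noteq> f b"
    and step: "\<And>n f \<epsilon>. P n f \<Longrightarrow> \<epsilon> > 0 \<Longrightarrow>
        \<exists>f'. P (Suc n) f' \<and> (\<forall>a\<in>topspace X. d (f a) (f' a) < \<epsilon>)"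
    and \<epsilon>: "\<epsilon> > 0"
  obtains h where "homeomorphic_map X mtopology h" "\<And>a. a \<in> topspace X \<Longrightarrow> d (f0 a) (h a) < \<epsilon>"
proof -
  \<comment> \<open>The distance of the images attains a positive minimum on the compact
    \<open>K n\<close>. The factor 2 lets both points of a pair move by \<open>e\<close> in the
    limit without meeting.\<close>
  have gap: "\<exists>e>0. e \<le> c \<and> (\<forall>a b. (a, b) \<in> K n \<longrightarrow> d (f a) (f b) > 2 * e)"
    if "P n f" "c > 0" for n f c
  proof (cases "K n = {}")
    case True
    then show ?thesis using that by auto
  next
    case False
    let ?D = "\<lambda>p. d (f (fst p)) (f (snd p))"
    have KX: "K n \<subseteq> topspace X \<times> topspace X"
      using compactin_subset_topspace[OF K(1)[of n]] by simp
    have fM: "f a \<in> M" if "a \<in> topspace X" for a using surj[OF \<open>P n f\<close>] that by blast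
    have "continuous_map (prod_topology X X) euclideanreal ?D"
      using continuous_map_compose[OF continuous_map_fst cont[OF that(1)]]
        continuous_map_compose[OF continuous_map_snd cont[OF that(1)]]
      by (intro continuous_map_mdist[of _ "metric (M, d)", simplified]) (simp_all add: o_def)
    then have "compactin euclideanreal (?D ` K n)"
      using image_compactin K(1) by blast
    then have "compact (?D ` K n)" by simp
    then obtain p where p: "p \<in> K n" "\<And>q. q \<in> K n \<Longrightarrow> ?D p \<le> ?D q"
      using compact_attains_inf[of "?D ` K n"] False by auto
    have "?D p > 0"
      using p(1) KX sep[OF that(1), of "fst p" "snd p"] fM by (cases p) (auto intro!: mdist_pos_less)
    then show ?thesis using p(2) that(2)
      by (intro exI[of _ "min c (?D p / 3)"]) (fastforce simp: min_def)
  qed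
  define Q where "Q n fe \<longleftrightarrow> P n (fst fe) \<and> snd fe > 0 \<and> snd fe \<le> \<epsilon> / 2 \<and>
      (\<forall>a b. (a, b) \<in> K n \<longrightarrow> d (fst fe a) (fst fe b) > 2 * snd fe)" for n fe
  have "\<exists>s. \<forall>n. Q n (s n) \<and> (n = 0 \<longrightarrow> fst (s n) = f0)  \<and> (snd (s (Suc n)) \<le> snd (s n) / 2 \<and>
      (\<forall>a\<in>topspace X. d (fst (s n) a) (fst (s (Suc n)) a) < snd (s n) / 2))"
  proof -
    have 1: "\<exists>x. Q 0 x \<and> (0 = (0::nat) \<longrightarrow> fst x = f0)"
    proof -
      obtain e where "e > 0" "e \<le> \<epsilon> / 2" "\<forall>a b. (a, b) \<in> K 0 \<longrightarrow> d (f0 a) (f0 b) > 2 * e"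
        using gap[OF P0, of "\<epsilon> / 2"] \<epsilon> by auto
      then show ?thesis using P0 by (intro exI[of _ "(f0, e)"]) (auto simp: Q_def)
    qed
    have 2: "\<exists>z. (Q (Suc n) z \<and> (Suc n = 0 \<longrightarrow> fst z = f0)) \<and> (snd z \<le> snd x / 2 \<and>
        (\<forall>a\<in>topspace X. d (fst x a) (fst z a) < snd x / 2))" if "Q n x \<and> (n = 0 \<longrightarrow> fst x = f0)" for x n
    proof -
      have "P n (fst x)" "snd x / 2 > 0" "snd x / 2 \<le> \<epsilon> / 2" using that unfolding Q_def by auto
      moreover obtain f' where f': "P (Suc n) f'" "\<forall>a\<in>topspace X. d (fst x a) (f' a) < snd x / 2"
        using step calculation by blast
      moreover obtain e where "e > 0" "e \<le> snd x / 2" "\<forall>a b. (a, b) \<in> K (Suc n) \<longrightarrow> d (f' a) (f' b) > 2 * e"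
        using gap[OF f'(1), of "snd x / 2"] calculation by auto
      ultimately show ?thesis
        by (intro exI[of _ "(f', e)"]) (auto simp: Q_def)
    qed
    show ?thesis
      using dependent_nat_choice[of "\<lambda>n x. Q n x \<and> (n = 0 \<longrightarrow> fst x = f0)"
        "\<lambda>n x z. snd z \<le> snd x / 2 \<and> (\<forall>a\<in>topspace X. d (fst x a) (fst z a) < snd x / 2)", OF 1 2]
      by auto
  qed
  then obtain s where s: "\<And>n. Q n (s n)" "fst (s 0) = f0" "\<And>n. snd (s (Suc n)) \<le> snd (s n) / 2"
    "\<And>n a. a \<in> topspace X \<Longrightarrow> d (fst (s n) a) (fst (s (Suc n)) a) < snd (s n) / 2" by blast
  define f where "f n = fst (s n)" for n
  define e where "e n = snd (s n)" for n
  have fP: "P n (f n)" and e0: "e n > 0" and eps: "e n \<le> \<epsilon> / 2"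
    and fK: "\<And>a b. (a, b) \<in> K n \<Longrightarrow> d (f n a) (f n b) > 2 * e n" for n
    using s(1)[of n] by (auto simp: Q_def f_def e_def)
  have fM: "f n a \<in> M" if "a \<in> topspace X" for a n using surj[OF fP] that by blast
  \<comment> \<open>The n-th move is below \<open>e n / 2\<close> and \<open>e\<close> at least
    halves at each step, so the moves telescope. Subtracting \<open>e (n + k)\<close> makes the
    induction close.\<close>
  have dd: "d (f n a) (f (n + k) a) \<le> e n - e (n + k)" if a: "a \<in> topspace X" for n k a
  proof (induction k)
    case 0
    then show ?case using fM[OF a] by simp
  next
    case (Suc k)
    have "d (f n a) (f (n + Suc k) a) \<le> d (f n a) (f (n + k) a) + d (f (n + k) a) (f (Suc (n + k)) a)"
      using triangle fM[OF a] by simp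
    also have "\<dots> \<le> e n - e (n + k) + e (n + k) / 2"
      using Suc s(4)[OF a, of "n + k"] by (simp add: f_def e_def)
    also have "\<dots> \<le> e n - e (n + Suc k)" using s(3)[of "n + k"] by (simp add: e_def)
    finally show ?case .
  qed
  have elim: "e n \<le> e 0 / 2 ^ n" for n
  proof (induction n)
    case (Suc n)
    then have "e n / 2 \<le> e 0 / 2 ^ Suc n" by simp
    then show ?case using s(3)[of n] unfolding e_def by linarith
  qed simp
  have eto0: "\<exists>N. \<forall>n\<ge>N. e n < r" if "r > 0" for r
  proof -
    have "(\<lambda>n. e 0 * (1 / 2) ^ n) \<longlonglongrightarrow> e 0 * 0"
      by (intro tendsto_mult tendsto_const LIMSEQ_realpow_zero) auto
    then have "\<forall>\<^sub>F n in sequentially. e 0 * (1 / 2) ^ n < r"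
      using that by (intro order_tendstoD(2)) auto
    then obtain N where "\<forall>n\<ge>N. e 0 * (1 / 2) ^ n < r" by (auto simp: eventually_sequentially)
    then have "\<forall>n\<ge>N. e 0 / 2 ^ n < r" by (simp add: power_divide)
    then show ?thesis using elim order_le_less_trans by blast
  qed
  have Cau: "\<exists>N. \<forall>m n x. N \<le> m \<longrightarrow> N \<le> n \<longrightarrow> x \<in> topspace X \<longrightarrow> d (f m x) (f n x) < r" if r: "r > 0" for r
  proof -
    obtain N where N: "\<forall>n\<ge>N. e n < r" using eto0[OF r] by blast
    have "d (f m x) (f n x) < r" if "N \<le> m" "m \<le> n" "x \<in> topspace X" for m n x
      using dd[OF that(3), of m "n - m"] that e0[of n] N by fastforce
    then show ?thesis by (metis commute linear)
  qed
  obtain h where h: "continuous_map X mtopology h"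
    "\<And>r. 0 < r \<Longrightarrow> \<forall>\<^sub>F n in sequentially. \<forall>x\<in>topspace X. d (f n x) (h x) < r"
    using continuous_map_uniformly_Cauchy_limit[OF compact_space_imp_mcomplete[OF M] _ Cau]
      cont[OF fP] by (metis (mono_tags) always_eventually)
  have hM: "h a \<in> M" if "a \<in> topspace X" for a
    using h(1) that continuous_map_image_subset_topspace by fastforce
  have dh: "d (f n a) (h a) \<le> e n" if a: "a \<in> topspace X" for n a
  proof (rule field_le_epsilon)
    fix r :: real assume r: "r > 0"
    obtain N where N: "\<forall>m\<ge>N. \<forall>x\<in>topspace X. d (f m x) (h x) < r"
      using h(2)[OF r] by (auto simp: eventually_sequentially)
    have "d (f n a) (h a) \<le> d (f n a) (f (n + N) a) + d (f (n + N) a) (h a)"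
      using triangle fM[OF a] hM[OF a] by simp
    also have "\<dots> \<le> e n + r" using dd[OF a, of n N] e0[of "n + N"] N a by (smt (verit) le_add2)
    finally show "d (f n a) (h a) \<le> e n + r" .
  qed
  have inj: "inj_on h (topspace X)"
  proof (rule inj_onI, rule ccontr)
    fix a b assume ab: "a \<in> topspace X" "b \<in> topspace X" "h a = h b" "a \<noteq> b"
    then obtain n where "(a, b) \<in> K n" using K(2) by blast
    then have "2 * e n < d (f n a) (f n b)" using fK by blast
    also have "\<dots> \<le> d (f n a) (h a) + d (h b) (f n b)"
      using triangle fM hM ab by metis
    also have "\<dots> \<le> e n + e n" using dh ab commute by (metis add_mono)
    finally show False by simp
  qed
  have clo: "closedin mtopology (h ` topspace X)"
    using compactin_imp_closedin_gen[OF Hausdorff_imp_kc_space[OF Hausdorff_space_mtopology]]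
      image_compactin[OF _ h(1)] X by (metis compact_space_def)
  \<comment> \<open>The image of \<open>h\<close> is compact, hence closed, and it is dense because
    each \<open>f n\<close> is onto and within \<open>e n\<close> of \<open>h\<close>.\<close>
  have hsurj: "h ` topspace X = M"
  proof (rule equalityI)
    show "M \<subseteq> h ` topspace X"
    proof
      fix z assume z: "z \<in> M"
      have "\<exists>w\<in>h ` topspace X. w \<in> mball z r" if r: "r > 0" for r
      proof -
        obtain n where n: "e n < r" using eto0[OF r] by blast
        obtain a where a: "a \<in> topspace X" "f n a = z" using surj[OF fP[of n]] z by blast
        then show ?thesis using dh[OF a(1), of n] n hM z by (intro bexI[of _ "h a"]) auto
      qed
      then have "z \<in> mtopology closure_of (h ` topspace X)"
        using z by (simp add: metric_closure_of)
      then show "z \<in> h ` topspace X" using clo by (simp add: closure_of_closedin)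
    qed
  qed (use hM in blast)
  show thesis
  proof
    show "homeomorphic_map X mtopology h"
      using continuous_imp_closed_map_gen[OF X Hausdorff_imp_kc_space[OF Hausdorff_space_mtopology] h(1)]
      by (intro bijective_closed_imp_homeomorphic_map h(1) inj) (simp_all add: hsurj)
    show "d (f0 a) (h a) < \<epsilon>" if "a \<in> topspace X" for a
      using dh[OF that, of 0] eps[of 0] \<epsilon> s(2) by (simp add: f_def)
  qed
qed

section \<open>Blowing up countably many points\<close>

lemma continuous_map_scaleR:
  fixes g :: "'a \<Rightarrow> 'b::real_normed_vector"
  assumes "continuous_map T euclideanreal f" "continuous_map T euclidean g"
  shows "continuous_map T euclidean (\<lambda>x. f x *\<^sub>R g x)"
proof -
  have "continuous_map (prod_topology euclideanreal euclidean) euclidean (\<lambda>(c, v). c *\<^sub>R v :: 'b)"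
    unfolding prod_topology_euclidean continuous_map_iff_continuous2 case_prod_unfold
    by (intro continuous_intros)
  moreover have "continuous_map T (prod_topology euclideanreal euclidean) (\<lambda>x. (f x, g x))"
    unfolding continuous_map_pairwise using assms by (simp add: o_def)
  ultimately have "continuous_map T euclidean ((\<lambda>(c, v). c *\<^sub>R v) \<circ> (\<lambda>x. (f x, g x)))"
    by (intro continuous_map_compose)
  then show ?thesis by (simp add: o_def)
qed

text \<open>
  The equation determines \<open>t\<close> where \<open>\<mu> z \<noteq> 0\<close> and leaves a whole ball of values over the zero
  of \<open>\<mu>\<close>; stated without a division, it visibly cuts out a closed set.
\<close>

definition blowup_points ::
    "'m topology \<Rightarrow> ('m \<Rightarrow> real) \<Rightarrow> ('m \<Rightarrow> 'e::real_normed_vector) \<Rightarrow> ('m \<times> 'e) set" where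
  "blowup_points T \<mu> \<kappa> = {(z, t). z \<in> topspace T \<and> norm t \<le> 1 \<and> \<mu> z *\<^sub>R t = \<kappa> z}"

text \<open>
  The last clause says that the blow-up at \<open>p\<close> is homeomorphic to the space, by a map that
  differs from the projection only over an arbitrarily small neighbourhood of \<open>p\<close>.
\<close>

definition blowup_model ::
    "'m topology \<Rightarrow> 'm \<Rightarrow> ('m \<Rightarrow> real) \<Rightarrow> ('m \<Rightarrow> 'e::real_normed_vector) \<Rightarrow> bool" where
  "blowup_model T p \<mu> \<kappa> \<longleftrightarrow>
     p \<in> topspace T \<and> continuous_map T euclideanreal \<mu> \<and> continuous_map T euclidean \<kappa> \<and>
     (\<forall>z\<in>topspace T. 0 \<le> \<mu> z \<and> (\<mu> z = 0 \<longleftrightarrow> z = p) \<and> norm (\<kappa> z) \<le> \<mu> z) \<and>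
     (\<forall>V. openin T V \<and> p \<in> V \<longrightarrow> (\<exists>N B. closedin T N \<and> N \<subseteq> V \<and>
       continuous_map (subtopology (prod_topology T euclidean) (blowup_points T \<mu> \<kappa>)) T B \<and>
       bij_betw B (blowup_points T \<mu> \<kappa>) (topspace T) \<and>
       (\<forall>a\<in>blowup_points T \<mu> \<kappa>. if fst a \<in> N then B a \<in> N else B a = fst a)))"

text \<open>No compatibility between the models at different points is asked for: away from
  \<open>p\<close> the coordinate at \<open>p\<close> is a continuous function of the base point
  alone.\<close>

locale blowup = Metric_space M d for M :: "'m set" and d +
  fixes P :: "'m set" and \<mu> :: "'m \<Rightarrow> 'm \<Rightarrow> real" and \<kappa> :: "'m \<Rightarrow> 'm \<Rightarrow> 'e::euclidean_space"
  assumes compact: "compact_space mtopology"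
    and countable_P: "countable P" and P_nonempty: "P \<noteq> {}"
    and model: "\<And>p. p \<in> P \<Longrightarrow> blowup_model mtopology p (\<mu> p) (\<kappa> p)"
begin

abbreviation ambient :: "('m \<times> ('m \<Rightarrow> 'e)) topology" where
  "ambient \<equiv> prod_topology mtopology (product_topology (\<lambda>_. euclidean) P)"

text \<open>This is the fibre product over \<open>M\<close> of all the single blow-ups. Over a point
  outside \<open>P\<close> it is a singleton; over \<open>p\<close> in \<open>P\<close> exactly the
  coordinate at \<open>p\<close> is free, ranging over the closed unit ball.\<close>

definition points :: "('m \<times> ('m \<Rightarrow> 'e)) set" where
  "points = {a. fst a \<in> M \<and> snd a \<in> extensional P \<and>
     (\<forall>p\<in>P. (fst a, snd a p) \<in> blowup_points mtopology (\<mu> p) (\<kappa> p))}"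

definition blowup_top :: "('m \<times> ('m \<Rightarrow> 'e)) topology" where
  "blowup_top = subtopology ambient points"

lemma P_subset: "P \<subseteq> M"
  using model by (auto simp: blowup_model_def)

lemma topspace_blowup_top [simp]: "topspace blowup_top = points"
  by (auto simp: blowup_top_def points_def PiE_iff extensional_def)

lemma fst_in: "a \<in> points \<Longrightarrow> fst a \<in> M"
  by (simp add: points_def)

lemma continuous_map_blowup_fst: "continuous_map blowup_top mtopology fst"
  unfolding blowup_top_def by (intro continuous_map_from_subtopology continuous_map_fst)

lemma continuous_map_coordinate: "p \<in> P \<Longrightarrow> continuous_map blowup_top euclidean (\<lambda>a. snd a p)"
  using continuous_map_from_subtopology[OF continuous_map_compose[OF continuous_map_snd
      continuous_map_product_projection]]
  by (simp add: blowup_top_def o_def)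

lemma continuous_map_into_blowup:
  assumes "continuous_map T mtopology (\<lambda>x. fst (f x))"
    and "\<And>p. p \<in> P \<Longrightarrow> continuous_map T euclidean (\<lambda>x. snd (f x) p)"
    and "f ` topspace T \<subseteq> points"
  shows "continuous_map T blowup_top f"
  unfolding blowup_top_def continuous_map_in_subtopology
proof
  have "continuous_map T (product_topology (\<lambda>_. euclidean) P) (\<lambda>x. snd (f x))"
    unfolding continuous_map_componentwise
  proof (intro conjI ballI image_subsetI)
    fix x assume "x \<in> topspace T"
    then have "f x \<in> points" using assms(3) by blast
    then show "snd (f x) \<in> extensional P" by (simp add: points_def)
  qed (rule assms(2))
  then show "continuous_map T ambient f"
    using assms(1) by (simp add: continuous_map_pairwise o_def)
qed (use assms(3) in auto)

text \<open>The defining conditions are closed, so \<open>points\<close> is a closed part of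
  \<open>M\<close> times a product of closed unit balls, which is compact by Tychonoff.\<close>

lemma compact_space_blowup_top: "compact_space blowup_top"
proof -
  have cont: "continuous_map ambient mtopology fst"
    "\<And>p. p \<in> P \<Longrightarrow> continuous_map ambient euclidean (\<lambda>a. snd a p)"
    using continuous_map_compose[OF continuous_map_snd continuous_map_product_projection]
    by (auto simp: o_def continuous_map_fst)
  have \<mu>: "continuous_map ambient euclideanreal (\<lambda>a. \<mu> p (fst a))"
    and \<kappa>: "continuous_map ambient euclidean (\<lambda>a. \<kappa> p (fst a))" if "p \<in> P" for p
    using model[OF that] continuous_map_compose[OF cont(1)]
    by (auto simp: blowup_model_def o_def)
  define C where "C p = {a \<in> topspace ambient. norm (snd a p) \<in> {..1}} \<inter>
      {a \<in> topspace ambient. \<mu> p (fst a) *\<^sub>R snd a p - \<kappa> p (fst a) \<in> {0}}" for p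
  have "closedin ambient (C p)" if p: "p \<in> P" for p
    unfolding C_def
    by (intro closedin_Int closedin_continuous_map_preimage[where Y = euclidean] continuous_map_norm
        continuous_map_diff continuous_map_scaleR cont(2) \<mu> \<kappa> p) auto
  then have clo: "closedin ambient (\<Inter>p\<in>P. C p)"
    using P_nonempty by (intro closedin_Inter) auto
  have C_iff: "a \<in> C p \<longleftrightarrow> fst a \<in> M \<and> snd a \<in> extensional P \<and>
      (fst a, snd a p) \<in> blowup_points mtopology (\<mu> p) (\<kappa> p)" for a p
    by (cases a) (auto simp: C_def blowup_points_def PiE_iff)
  have eq: "points = (\<Inter>p\<in>P. C p)"
    unfolding set_eq_iff INT_iff C_iff points_def mem_Collect_eq using P_nonempty by blast
  have "compactin ambient (M \<times> PiE P (\<lambda>_. cball 0 1))"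
    using compact by (auto simp: compactin_Times compactin_PiE compact_space_def)
  moreover have "points \<subseteq> M \<times> PiE P (\<lambda>_. cball 0 1)"
    by (auto simp: points_def blowup_points_def PiE_iff extensional_def)
  ultimately have "compactin ambient points"
    using closed_compactin clo unfolding eq by blast
  then show ?thesis
    unfolding blowup_top_def by (simp add: compact_space_subtopology)
qed

lemma \<mu>_zero_iff: "p \<in> P \<Longrightarrow> z \<in> M \<Longrightarrow> \<mu> p z = 0 \<longleftrightarrow> z = p"
  using model by (auto simp: blowup_model_def)

lemma coordinate_off_point:
  assumes "a \<in> points" "p \<in> P" "fst a \<noteq> p"
  shows "snd a p = \<kappa> p (fst a) /\<^sub>R \<mu> p (fst a)"
proof -
  have "\<mu> p (fst a) *\<^sub>R snd a p = \<kappa> p (fst a)" "\<mu> p (fst a) \<noteq> 0"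
    using assms \<mu>_zero_iff by (auto simp: points_def blowup_points_def)
  then show ?thesis by (metis scaleR_scaleR left_inverse scaleR_one)
qed

lemma norm_coordinate: "a \<in> points \<Longrightarrow> p \<in> P \<Longrightarrow> norm (snd a p) \<le> 1"
  by (auto simp: points_def blowup_points_def)

text \<open>Every coordinate except the one at the base point itself is forced by
  \<open>coordinate_off_point\<close>.\<close>

lemma points_eqI:
  assumes "a \<in> points" "b \<in> points" "fst a = fst b" "fst a \<in> P \<Longrightarrow> snd a (fst a) = snd b (fst a)"
  shows "a = b"
proof -
  have "snd a p = snd b p" for p
  proof (cases "p \<in> P")
    case True
    then show ?thesis
      using assms coordinate_off_point[of a p] coordinate_off_point[of b p] by (cases "fst a = p") auto
  next
    case False
    then show ?thesis using assms(1,2) by (auto simp: points_def extensional_def)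
  qed
  then show ?thesis using assms(3) by (simp add: prod_eq_iff fun_eq_iff)
qed

text \<open>The argument \<open>t\<close> matters only for \<open>z\<close> in \<open>P\<close>;
  over any other point all lifts coincide.\<close>

definition lift :: "'m \<Rightarrow> 'e \<Rightarrow> 'm \<times> ('m \<Rightarrow> 'e)" where
  "lift z t = (z, \<lambda>p\<in>P. if z = p then t else \<kappa> p z /\<^sub>R \<mu> p z)"

lemma fst_lift [simp]: "fst (lift z t) = z"
  by (simp add: lift_def)

lemma snd_lift [simp]: "z \<in> P \<Longrightarrow> snd (lift z t) z = t"
  by (simp add: lift_def)

lemma lift_in [simp]:
  assumes z: "z \<in> M" and t: "norm t \<le> 1"
  shows "lift z t \<in> points"
proof -
  have "(z, if z = p then t else \<kappa> p z /\<^sub>R \<mu> p z) \<in> blowup_points mtopology (\<mu> p) (\<kappa> p)"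
    if p: "p \<in> P" for p
  proof -
    have *: "0 \<le> \<mu> p z" "norm (\<kappa> p z) \<le> \<mu> p z"
      using model[OF p] z by (auto simp: blowup_model_def)
    show ?thesis
    proof (cases "z = p")
      case True
      then have "\<mu> p z = 0" using \<mu>_zero_iff p z by blast
      then show ?thesis using * t z True by (simp add: blowup_points_def)
    next
      case False
      then have "\<mu> p z > 0" using * \<mu>_zero_iff[OF p z] by linarith
      then show ?thesis using * z False by (simp add: blowup_points_def field_simps)
    qed
  qed
  then show ?thesis using z by (simp add: points_def lift_def)
qed

declare fst_in [simp]

text \<open>\<open>f\<close> separates points like the projection, except that the balls over \<open>S\<close> are not collapsed.\<close>

definition resolves :: "'m set \<Rightarrow> ('m \<times> ('m \<Rightarrow> 'e) \<Rightarrow> 'm) \<Rightarrow> bool" where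
  "resolves S f \<longleftrightarrow> continuous_map blowup_top mtopology f \<and> f ` points = M \<and>
     (\<forall>a\<in>points. \<forall>b\<in>points. f a = f b \<longleftrightarrow>
       fst a = fst b \<and> (fst a \<in> S \<longrightarrow> snd a (fst a) = snd b (fst a)))"

section \<open>Opening the balls one at a time: approximating the projection by
  homeomorphisms\<close>

lemma fst_image_points: "fst ` points = M"
proof (intro equalityI subsetI)
  fix z assume "z \<in> M"
  then show "z \<in> fst ` points" by (intro image_eqI[of _ _ "lift z 0"]) auto
qed (use fst_in in blast)

lemma resolves_empty: "resolves {} fst"
  unfolding resolves_def using continuous_map_blowup_fst fst_image_points by blast

text \<open>One Bing step. Away from the balls over \<open>S\<close> the map \<open>f\<close>
  factors through the projection as \<open>F\<close>. Replacing the projection by the blow-up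
  homeomorphism \<open>B\<close> at \<open>p\<close>, which differs from it only over a small
  \<open>N\<close> missing \<open>S\<close>, opens the ball over \<open>p\<close> and leaves the
  other fibres as they were.\<close>

lemma resolves_insert:
  assumes f: "resolves S f" and S: "finite S" "S \<subseteq> P" and p: "p \<in> P" and \<epsilon>: "\<epsilon> > 0"
  shows "\<exists>f'. resolves (insert p S) f' \<and> (\<forall>a\<in>points. d (f a) (f' a) < \<epsilon>)"
proof (cases "p \<in> S")
  case True
  moreover have "d (f a) (f a) = 0" if "a \<in> points" for a
  proof -
    have "f a \<in> M" using f that unfolding resolves_def by blast
    then show ?thesis by simp
  qed
  ultimately show ?thesis using f \<epsilon> by (intro exI[of _ f]) (auto simp: insert_absorb)
next
  case False
  have contf: "continuous_map blowup_top mtopology f" and fim: "f ` points = M"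
    and fib: "\<And>a b. a \<in> points \<Longrightarrow> b \<in> points \<Longrightarrow> f a = f b \<longleftrightarrow>
       fst a = fst b \<and> (fst a \<in> S \<longrightarrow> snd a (fst a) = snd b (fst a))"
    using f by (auto simp: resolves_def)
  \<comment> \<open>Off \<open>S\<close> the map \<open>f\<close> sees only the base point, so the
    fibre value 0 is an arbitrary choice.\<close>
  define F where "F z = f (lift z 0)" for z
  have Ff: "F (fst a) = f a" if "a \<in> points" "fst a \<notin> S" for a
    unfolding F_def using that by (subst fib) auto
  have pM: "p \<in> M" using p P_subset by blast
  have opS: "openin mtopology (M - S)"
    using S P_subset closedin_Hausdorff_finite[OF Hausdorff_space_mtopology, of S]
    by (auto simp: closedin_def)
  let ?pre = "{a \<in> points. fst a \<in> M - S}"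
  \<comment> \<open>\<open>F\<close> inherits continuity from \<open>f\<close> because the
    projection, a closed surjection, is a quotient map and stays one over the open set
    \<open>M - S\<close>.\<close>
  have quot: "quotient_map blowup_top mtopology fst"
    using continuous_imp_closed_map_gen[OF compact_space_blowup_top
        Hausdorff_imp_kc_space[OF Hausdorff_space_mtopology] continuous_map_blowup_fst]
    by (intro continuous_closed_imp_quotient_map continuous_map_blowup_fst)
      (simp_all add: fst_image_points)
  have "quotient_map (subtopology blowup_top ?pre) (subtopology mtopology (M - S)) fst"
    by (rule quotient_map_restriction[OF quot]) (use opS in auto)
  moreover have "continuous_map (subtopology blowup_top ?pre) mtopology (F \<circ> fst)"
    by (rule continuous_map_eq[OF continuous_map_from_subtopology[OF contf]]) (auto simp: Ff)
  ultimately have contF: "continuous_map (subtopology mtopology (M - S)) mtopology F"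
    by (rule continuous_compose_quotient_map)
  have FM: "F z \<in> M" if "z \<in> M" for z
    unfolding F_def using fim that lift_in[of z 0] by auto
  \<comment> \<open>Old and new values over \<open>N\<close> both lie within
    \<open>\<epsilon> / 2\<close> of \<open>F p\<close>, so the change stays below
    \<open>\<epsilon>\<close>.\<close>
  define V where "V = {z \<in> topspace (subtopology mtopology (M - S)). F z \<in> mball (F p) (\<epsilon> / 2)}"
  have "openin (subtopology mtopology (M - S)) V"
    unfolding V_def by (rule openin_continuous_map_preimage[OF contF]) auto
  then have V: "openin mtopology V" using opS openin_trans_full by blast
  have pV: "p \<in> V" using False pM FM \<epsilon> by (auto simp: V_def)
  let ?Z = "blowup_points mtopology (\<mu> p) (\<kappa> p)"
  obtain N B where N: "closedin mtopology N" "N \<subseteq> V"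
    and B: "continuous_map (subtopology (prod_topology mtopology euclidean) ?Z) mtopology B"
       "bij_betw B ?Z M"
       "\<And>a. a \<in> ?Z \<Longrightarrow> if fst a \<in> N then B a \<in> N else B a = fst a"
    using model[OF p] V pV unfolding blowup_model_def topspace_mtopology by meson
  have NS: "N \<subseteq> M - S" using N(2) by (auto simp: V_def)
  define \<beta> where "\<beta> a = B (fst a, snd a p)" for a
  have Z: "(fst a, snd a p) \<in> ?Z" if "a \<in> points" for a
    using that p by (simp add: points_def del: fst_in)
  have \<beta>M: "\<beta> a \<in> M" if "a \<in> points" for a
    using B(2) Z[OF that] by (auto simp: \<beta>_def bij_betw_def)
  have \<beta>N: "\<beta> a \<in> N" if "a \<in> points" "fst a \<in> N" for a
    using B(3)[OF Z[OF that(1)]] that by (auto simp: \<beta>_def)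
  have \<beta>id: "\<beta> a = fst a" if "a \<in> points" "fst a \<notin> N" for a
    using B(3)[OF Z[OF that(1)]] that by (auto simp: \<beta>_def)
  have \<beta>S: "\<beta> a \<in> S \<longleftrightarrow> fst a \<in> S" if "a \<in> points" for a
    using \<beta>N[OF that] \<beta>id[OF that] NS by (cases "fst a \<in> N") auto
  have cont\<beta>: "continuous_map blowup_top mtopology \<beta>"
  proof -
    have "continuous_map blowup_top (subtopology (prod_topology mtopology euclidean) ?Z) (\<lambda>a. (fst a, snd a p))"
      using continuous_map_blowup_fst continuous_map_coordinate[OF p] Z
      by (auto simp: continuous_map_in_subtopology continuous_map_pairwise o_def)
    from continuous_map_compose[OF this B(1)] show ?thesis by (simp add: o_def \<beta>_def[abs_def])
  qed
  have \<beta>eq: "\<beta> a = \<beta> b \<longleftrightarrow> fst a = fst b \<and> snd a p = snd b p" if "a \<in> points" "b \<in> points" for a b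
    using B(2) Z that unfolding \<beta>_def bij_betw_def inj_on_def by (metis prod.inject)
  define f' where "f' a = (if fst a \<in> N then F (\<beta> a) else f a)" for a
  \<comment> \<open>Pointwise, \<open>f'\<close> is \<open>f\<close> after this self-map of
    \<open>points\<close>, so the description of the fibres of \<open>f\<close> can be reused for
    \<open>f'\<close>.\<close>
  define \<tau> where "\<tau> a = (if fst a \<in> S then a else lift (\<beta> a) 0)" for a
  have \<tau>: "\<tau> a \<in> points" if "a \<in> points" for a
    using that \<beta>M by (auto simp: \<tau>_def)
  have f'F: "f' a = F (\<beta> a)" if "a \<in> points" "fst a \<notin> S" for a
    using that \<beta>id Ff by (auto simp: f'_def)
  have f'\<tau>: "f' a = f (\<tau> a)" if "a \<in> points" for a
    using that f'F[OF that] NS by (auto simp: \<tau>_def F_def f'_def)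
  \<comment> \<open>The open pieces over \<open>M - S\<close> and over \<open>M - N\<close> cover
    everything because \<open>N\<close> misses \<open>S\<close>; on their overlap
    \<open>\<beta>\<close> is the projection.\<close>
  have cont': "continuous_map blowup_top mtopology f'"
  proof (rule pasting_lemma[of "{True, False}" blowup_top "\<lambda>i. if i then ?pre else {a \<in> points. fst a \<in> M - N}"
        _ "\<lambda>i. if i then F \<circ> \<beta> else f"])
    have "openin blowup_top {a \<in> topspace blowup_top. fst a \<in> M - S}" "openin blowup_top {a \<in> topspace blowup_top. fst a \<in> M - N}"
      using N(1) opS by (intro openin_continuous_map_preimage[OF continuous_map_blowup_fst]; auto)+
    then show "openin blowup_top (if i then ?pre else {a \<in> points. fst a \<in> M - N})" for i by simp
    have "continuous_map (subtopology blowup_top ?pre) (subtopology mtopology (M - S)) \<beta>"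
      using continuous_map_from_subtopology[OF cont\<beta>] \<beta>M \<beta>S
      by (auto simp: continuous_map_in_subtopology)
    from continuous_map_compose[OF this contF]
    show "continuous_map (subtopology blowup_top (if i then ?pre else {a \<in> points. fst a \<in> M - N})) mtopology
        (if i then F \<circ> \<beta> else f)" for i
      using continuous_map_from_subtopology[OF contf] by simp
  next
    fix i j :: bool and a
    assume "a \<in> topspace blowup_top \<inter> (if i then ?pre else {a \<in> points. fst a \<in> M - N}) \<inter>
        (if j then ?pre else {a \<in> points. fst a \<in> M - N})"
    then show "(if i then F \<circ> \<beta> else f) a = (if j then F \<circ> \<beta> else f) a"
      using \<beta>id Ff by (cases i; cases j) auto
  next
    fix a assume "a \<in> topspace blowup_top"
    then show "\<exists>j. j \<in> {True, False} \<and> a \<in> (if j then ?pre else {a \<in> points. fst a \<in> M - N}) \<and>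
        f' a = (if j then F \<circ> \<beta> else f) a"
      using NS by (intro exI[of _ "fst a \<in> N"]) (auto simp: f'_def)
  qed
  have "f' ` points = M"
  proof (intro equalityI subsetI)
    fix z assume "z \<in> M"
    then have "z \<in> f ` points" using fim by simp
    then obtain a where a: "a \<in> points" "f a = z" by auto
    show "z \<in> f' ` points"
    proof (cases "fst a \<in> S")
      case True
      then show ?thesis using a f'\<tau>[OF a(1)] by (intro image_eqI[of _ _ a]) (auto simp: \<tau>_def)
    next
      case False
      have "fst a \<in> B ` ?Z" using B(2) fst_in[OF a(1)] by (simp add: bij_betw_def)
      then obtain c where "fst a = B c" "c \<in> ?Z" by (rule imageE)
      then have c: "c \<in> ?Z" "B c = fst a" by simp_all
      let ?b = "lift (fst c) (snd c)"
      have cM: "fst c \<in> M" "norm (snd c) \<le> 1" using c(1) by (auto simp: blowup_points_def)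
      then have b: "?b \<in> points" by simp
      have "(fst ?b, snd ?b p) = c"
      proof (cases "fst c = p")
        case True
        then show ?thesis using p by (simp add: prod_eq_iff)
      next
        case False
        then have "snd ?b p = \<kappa> p (fst c) /\<^sub>R \<mu> p (fst c)" using coordinate_off_point[OF b p] by simp
        moreover have "\<mu> p (fst c) *\<^sub>R snd c = \<kappa> p (fst c)" using c(1) by (auto simp: blowup_points_def)
        moreover have "\<mu> p (fst c) \<noteq> 0" using False \<mu>_zero_iff p cM(1) by blast
        ultimately show ?thesis by (simp add: prod_eq_iff) (metis scaleR_scaleR left_inverse scaleR_one)
      qed
      then have "\<beta> ?b = fst a" using c(2) by (simp add: \<beta>_def)
      moreover have "fst ?b \<notin> S" using \<beta>S[OF b] calculation False by simp
      ultimately have "f' ?b = z" using f'F[OF b] Ff[OF a(1) False] a(2) by simp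
      then show ?thesis using b by blast
    qed
  qed (use f'\<tau> \<tau> fim in auto)
  moreover have "f' a = f' b \<longleftrightarrow> fst a = fst b \<and> (fst a \<in> insert p S \<longrightarrow> snd a (fst a) = snd b (fst a))"
    if ab: "a \<in> points" "b \<in> points" for a b
  proof -
    have coord: "snd a p = snd b p" if "fst a = fst b" "fst a \<noteq> p"
      using coordinate_off_point[OF ab(1) p] coordinate_off_point[OF ab(2) p] that by simp
    have "f' a = f' b \<longleftrightarrow> fst (\<tau> a) = fst (\<tau> b) \<and> (fst (\<tau> a) \<in> S \<longrightarrow>
        snd (\<tau> a) (fst (\<tau> a)) = snd (\<tau> b) (fst (\<tau> a)))"
      using fib[OF \<tau>[OF ab(1)] \<tau>[OF ab(2)]] f'\<tau> ab by simp
    also have "\<dots> \<longleftrightarrow> fst a = fst b \<and> (fst a \<in> insert p S \<longrightarrow> snd a (fst a) = snd b (fst a))"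
    proof (cases "fst a \<in> S")
      case True
      then show ?thesis using \<beta>S[OF ab(2)] False by (cases "fst b \<in> S") (auto simp: \<tau>_def)
    next
      case aS: False
      show ?thesis
      proof (cases "fst b \<in> S")
        case True
        then show ?thesis using \<beta>S[OF ab(1)] aS by (auto simp: \<tau>_def)
      next
        case bS: False
        have "\<beta> a \<notin> S" using \<beta>S ab aS by simp
        then have "?thesis \<longleftrightarrow> (\<beta> a = \<beta> b \<longleftrightarrow> fst a = fst b \<and> (fst a = p \<longrightarrow> snd a (fst a) = snd b (fst a)))"
          using aS bS by (auto simp: \<tau>_def)
        then show ?thesis using \<beta>eq[OF ab] coord by auto
      qed
    qed
    finally show ?thesis .
  qed
  moreover have "d (f a) (f' a) < \<epsilon>" if a: "a \<in> points" for a
  proof (cases "fst a \<in> N")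
    case True
    then have "fst a \<in> V" "\<beta> a \<in> V" using N(2) \<beta>N[OF a] by auto
    then have "d (F p) (F (fst a)) < \<epsilon> / 2" "d (F p) (F (\<beta> a)) < \<epsilon> / 2" by (auto simp: V_def)
    moreover have "F (fst a) = f a" "F (\<beta> a) = f' a"
      using True NS Ff[OF a] by (auto simp: f'_def)
    ultimately show ?thesis
      using triangle[of "f a" "F p" "f' a"] FM[OF pM] FM[OF \<beta>M[OF a]] FM[OF fst_in[OF a]] commute[of "f a" "F p"]
      by simp
  next
    case False
    then have "f' a = f a" by (simp add: f'_def)
    moreover have "f a \<in> M" using fim a by blast
    ultimately show ?thesis using \<epsilon> by simp
  qed
  ultimately show ?thesis using cont' unfolding resolves_def by blast
qed

text \<open>Starting from the projection, the balls are opened along an enumeration of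
  \<open>P\<close>, and the limit lemma keeps the result injective. Any two distinct points differ
  either in the base point or in the coordinate at one point of \<open>P\<close>, so they are
  separated from some stage on.\<close>

theorem homeomorphic_near_projection:
  assumes "\<epsilon> > 0"
  obtains h where "homeomorphic_map blowup_top mtopology h" "\<And>a. a \<in> points \<Longrightarrow> d (fst a) (h a) < \<epsilon>"
proof -
  \<comment> \<open>The enumeration repeats points when \<open>P\<close> is finite;
    \<open>resolves_insert\<close> allows a point that is already in the set.\<close>
  define S where "S n = from_nat_into P ` {..<n}" for n
  have S: "finite (S n)" "S n \<subseteq> P" for n
    using from_nat_into[OF P_nonempty] by (auto simp: S_def)
  have S_Suc: "S (Suc n) = insert (from_nat_into P n) (S n)" for n
    by (auto simp: S_def lessThan_Suc)
  have S_ex: "\<exists>n0. \<forall>n\<ge>n0. p \<in> S n" if p: "p \<in> P" for p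
  proof -
    obtain k where "from_nat_into P k = p" using from_nat_into_surj[OF countable_P p] ..
    then show ?thesis by (intro exI[of _ "Suc k"]) (auto simp: S_def)
  qed
  let ?XX = "prod_topology blowup_top blowup_top"
  define r where "r n = 1 / real (Suc n)" for n
  \<comment> \<open>A compact exhaustion of the pairs of distinct points, adapted to stage
    \<open>n\<close>: the base points, or the coordinates at an already opened ball, differ by at
    least \<open>r n\<close>. A map resolving \<open>S n\<close> separates all such pairs.\<close>
  define K where "K n = {ab \<in> topspace ?XX. d (fst (fst ab)) (fst (snd ab)) \<in> {r n..}} \<union>
      (\<Union>p\<in>S n. {ab \<in> topspace ?XX. norm (snd (fst ab) p - snd (snd ab) p) \<in> {r n..}})" for n
  have f1: "continuous_map ?XX T (\<lambda>ab. f (fst ab))" and f2: "continuous_map ?XX T (\<lambda>ab. f (snd ab))"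
    if "continuous_map blowup_top T f" for f and T :: "'z topology"
    using continuous_map_compose[OF continuous_map_fst that]
      continuous_map_compose[OF continuous_map_snd that] by (auto simp: o_def)
  have "closedin ?XX (K n)" for n
  proof -
    have "closedin ?XX {ab \<in> topspace ?XX. d (fst (fst ab)) (fst (snd ab)) \<in> {r n..}}"
      by (intro closedin_continuous_map_preimage[where Y = euclidean]
          continuous_map_mdist[of _ "metric (M, d)", simplified]
          f1[OF continuous_map_blowup_fst] f2[OF continuous_map_blowup_fst]) auto
    moreover have "closedin ?XX {ab \<in> topspace ?XX. norm (snd (fst ab) p - snd (snd ab) p) \<in> {r n..}}"
      if "p \<in> P" for p
      by (intro closedin_continuous_map_preimage[where Y = euclidean] continuous_map_norm
          continuous_map_diff f1[OF continuous_map_coordinate[OF that]]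
          f2[OF continuous_map_coordinate[OF that]]) auto
    ultimately show ?thesis
      unfolding K_def using S[of n] by (intro closedin_Un closedin_Union) auto
  qed
  then have K1: "compactin ?XX (K n)" for n
    using closedin_compact_space compact_space_prod_topology compact_space_blowup_top by blast
  have small: "\<exists>n0. \<forall>n\<ge>n0. r n \<le> c" if c: "c > 0" for c
  proof -
    obtain n0 where "r n0 < c" using reals_Archimedean[OF c] by (auto simp: r_def divide_inverse)
    moreover have "r n \<le> r n0" if "n \<ge> n0" for n using that by (simp add: r_def field_simps)
    ultimately show ?thesis by (meson less_imp_le order_trans)
  qed
  have K2: "\<exists>n. (a, b) \<in> K n" if ab: "a \<in> points" "b \<in> points" "a \<noteq> b" for a b
  proof (cases "fst a = fst b")
    case False
    then have "d (fst a) (fst b) > 0" using ab by simp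
    then obtain n where "r n \<le> d (fst a) (fst b)" using small by blast
    then show ?thesis using ab by (auto simp: K_def)
  next
    case True
    define p where "p = fst a"
    have p: "p \<in> P" "snd a p \<noteq> snd b p" using points_eqI[OF ab(1,2) True] ab(3) by (auto simp: p_def)
    then have "norm (snd a p - snd b p) > 0" by simp
    then obtain n0 where n0: "\<forall>n\<ge>n0. r n \<le> norm (snd a p - snd b p)" using small by blast
    obtain n1 where n1: "\<forall>n\<ge>n1. p \<in> S n" using S_ex p(1) by blast
    have "(a, b) \<in> K (max n0 n1)"
      using ab n0 n1 unfolding K_def by (intro UnI2 UN_I[of p]) auto
    then show ?thesis by blast
  qed
  have sep: "f a \<noteq> f b" if f: "resolves (S n) f" and ab: "(a, b) \<in> K n" for n f a b
  proof
    assume eq: "f a = f b"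
    have pts: "a \<in> points" "b \<in> points" using ab by (auto simp: K_def)
    then have *: "fst a = fst b" "fst a \<in> S n \<Longrightarrow> snd a (fst a) = snd b (fst a)"
      using f eq by (auto simp: resolves_def)
    have rn: "r n > 0" by (simp add: r_def)
    have "snd a p = snd b p" if "p \<in> S n" for p
      using that S(2)[of n] *  coordinate_off_point[OF pts(1), of p] coordinate_off_point[OF pts(2), of p]
      by (cases "fst a = p") auto
    then show False using ab * rn pts by (auto simp: K_def)
  qed
  show thesis
  proof (rule homeomorphic_map_limit[of blowup_top K "\<lambda>n. resolves (S n)" fst])
    show "\<exists>f'. resolves (S (Suc n)) f' \<and> (\<forall>a\<in>topspace blowup_top. d (f a) (f' a) < \<epsilon>)"
      if "resolves (S n) f" "\<epsilon> > 0" for n f \<epsilon>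
      using resolves_insert[OF that(1) S from_nat_into[OF P_nonempty] that(2)] by (simp add: S_Suc)
    show "resolves (S 0) fst" using resolves_empty by (simp add: S_def)
    show "continuous_map blowup_top mtopology f" "f ` topspace blowup_top = M"
      if "resolves (S n) f" for n f
      using that by (simp_all add: resolves_def)
    show "f a \<noteq> f b" if "resolves (S n) f" "(a, b) \<in> K n" for n f a b
      using sep that .
    show "\<exists>n. (a, b) \<in> K n" if "a \<in> topspace blowup_top" "b \<in> topspace blowup_top" "a \<noteq> b" for a b
      using K2 that by simp
    show thesis if "homeomorphic_map blowup_top mtopology h"
      "\<And>a. a \<in> topspace blowup_top \<Longrightarrow> d (fst a) (h a) < \<epsilon>" for h
      using \<open>\<And>h. homeomorphic_map blowup_top mtopology h \<Longrightarrow>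
        (\<And>a. a \<in> points \<Longrightarrow> d (fst a) (h a) < \<epsilon>) \<Longrightarrow> thesis\<close> that by simp
  qed (use K1 compact_space_blowup_top compact assms in auto)
qed

end

section \<open>Blow-up models from charts\<close>

text \<open>This carries the single model built from a chart at \<open>y\<close> to every other
  point of the orbit; \<open>B\<close> turns into its conjugate by \<open>h\<close>.\<close>

lemma blowup_model_transport:
  assumes model: "blowup_model T p \<mu> \<kappa>" and h: "homeomorphic_maps T T h h'"
  shows "blowup_model T (h p) (\<mu> \<circ> h') (\<kappa> \<circ> h')"
proof -
  have conth: "continuous_map T T h" and conth': "continuous_map T T h'"
    and inv: "\<And>x. x \<in> topspace T \<Longrightarrow> h' (h x) = x" "\<And>x. x \<in> topspace T \<Longrightarrow> h (h' x) = x"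
    using h by (auto simp: homeomorphic_maps_def)
  have in_T: "h x \<in> topspace T" "h' x \<in> topspace T" if "x \<in> topspace T" for x
    using conth conth' that by (auto simp: continuous_map_def)
  have p: "p \<in> topspace T" using model by (simp add: blowup_model_def)
  have bh: "bij_betw h (topspace T) (topspace T)"
    using inv in_T by (intro bij_betw_byWitness[of _ h']) auto
  let ?Z = "blowup_points T \<mu> \<kappa>" and ?Z' = "blowup_points T (\<mu> \<circ> h') (\<kappa> \<circ> h')"
  let ?k = "\<lambda>a. (h' (fst a), snd a)"
  have bk: "bij_betw ?k ?Z' ?Z"
    using inv in_T by (intro bij_betw_byWitness[of _ "\<lambda>a. (h (fst a), snd a)"])
      (auto simp: blowup_points_def)
  have contk: "continuous_map (subtopology (prod_topology T euclidean) ?Z')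
      (subtopology (prod_topology T euclidean) ?Z) ?k"
  proof -
    have "continuous_map (prod_topology T euclidean) (prod_topology T euclidean) ?k"
      unfolding continuous_map_pairwise o_def
      using continuous_map_compose[OF continuous_map_fst conth'] continuous_map_snd
      by (auto simp: o_def)
    then show ?thesis
      unfolding continuous_map_in_subtopology using bij_betw_imp_surj_on[OF bk]
      by (auto intro: continuous_map_from_subtopology)
  qed
  have "\<exists>N B. closedin T N \<and> N \<subseteq> V \<and>
       continuous_map (subtopology (prod_topology T euclidean) ?Z') T B \<and>
       bij_betw B ?Z' (topspace T) \<and> (\<forall>a\<in>?Z'. if fst a \<in> N then B a \<in> N else B a = fst a)"
    if V: "openin T V" "h p \<in> V" for V
  proof -
    have "openin T {z \<in> topspace T. h z \<in> V}" "p \<in> {z \<in> topspace T. h z \<in> V}"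
      using openin_continuous_map_preimage[OF conth V(1)] V(2) p by auto
    then obtain N B where N: "closedin T N" "N \<subseteq> {z \<in> topspace T. h z \<in> V}"
      and B: "continuous_map (subtopology (prod_topology T euclidean) ?Z) T B"
        "bij_betw B ?Z (topspace T)"
        "\<forall>a\<in>?Z. if fst a \<in> N then B a \<in> N else B a = fst a"
      using model unfolding blowup_model_def by meson
    let ?B = "h \<circ> (B \<circ> ?k)" and ?N = "{z \<in> topspace T. h' z \<in> N}"
    have "closedin T ?N" by (rule closedin_continuous_map_preimage[OF conth' N(1)])
    moreover have "?N \<subseteq> V" using N(2) inv(2) by fastforce
    moreover have "continuous_map (subtopology (prod_topology T euclidean) ?Z') T ?B"
      by (intro continuous_map_compose[OF _ conth] continuous_map_compose[OF contk B(1)])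
    moreover have "bij_betw ?B ?Z' (topspace T)"
      by (intro bij_betw_trans[OF _ bh] bij_betw_trans[OF bk B(2)])
    moreover have "if fst a \<in> ?N then ?B a \<in> ?N else ?B a = fst a" if a: "a \<in> ?Z'" for a
    proof -
      have *: "?k a \<in> ?Z" "fst a \<in> topspace T" using a in_T by (auto simp: blowup_points_def)
      have "B (?k a) \<in> topspace T" using B(2) *(1) by (auto simp: bij_betw_def)
      then show ?thesis
        using B(3)[rule_format, OF *(1)] *(2) inv in_T by (auto split: if_splits)
    qed
    ultimately show ?thesis by blast
  qed
  moreover have "continuous_map T euclideanreal (\<mu> \<circ> h')" "continuous_map T euclidean (\<kappa> \<circ> h')"
    using model conth' by (auto simp: blowup_model_def intro: continuous_map_compose)
  moreover have "0 \<le> \<mu> (h' z) \<and> (\<mu> (h' z) = 0 \<longleftrightarrow> z = h p) \<and> norm (\<kappa> (h' z)) \<le> \<mu> (h' z)"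
    if "z \<in> topspace T" for z
  proof -
    have "h' z = p \<longleftrightarrow> z = h p" using inv that p by auto
    then show ?thesis using model in_T(2)[OF that] by (simp add: blowup_model_def)
  qed
  ultimately show ?thesis
    using in_T(1)[OF p] unfolding blowup_model_def by simp
qed

text \<open>
  Over the unit ball of the chart the fibre coordinate \<open>t\<close> satisfies \<open>\<kappa> z = \<mu> z *\<^sub>R t\<close>, so
  \<open>((\<delta> + \<mu> z) / 2) *\<^sub>R t\<close> spreads the fibre over \<open>p\<close> to the ball of radius \<open>\<delta> / 2\<close> and the
  punctured ball of radius \<open>\<delta>\<close> to the remaining annulus.
\<close>

lemma blowup_modelI:
  fixes \<kappa> :: "'m \<Rightarrow> 'e::euclidean_space"
  assumes p: "p \<in> topspace T"
    and \<mu>: "continuous_map T euclideanreal \<mu>" and \<kappa>: "continuous_map T euclidean \<kappa>"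
    and \<psi>: "continuous_map (top_of_set (cball 0 1)) T \<psi>"
    and \<mu>\<kappa>: "\<And>z. z \<in> topspace T \<Longrightarrow> norm (\<kappa> z) \<le> \<mu> z"
    and \<psi>1: "\<And>u. norm u \<le> 1 \<Longrightarrow> \<kappa> (\<psi> u) = u \<and> \<mu> (\<psi> u) = norm u"
    and \<psi>2: "\<And>z. z \<in> topspace T \<Longrightarrow> \<mu> z \<le> 1 \<Longrightarrow> \<psi> (\<kappa> z) = z \<and> norm (\<kappa> z) = \<mu> z"
    and \<psi>0: "\<psi> 0 = p"
  shows "blowup_model T p \<mu> \<kappa>"
proof -
  have \<mu>0: "0 \<le> \<mu> z" if "z \<in> topspace T" for z using \<mu>\<kappa>[OF that] norm_ge_zero order_trans by blast
  have \<mu>p: "\<mu> p = 0" using \<psi>1[of 0] \<psi>0 by simp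
  have \<mu>z: "\<mu> z = 0 \<longleftrightarrow> z = p" if "z \<in> topspace T" for z
    using \<psi>2[OF that] \<mu>p \<psi>0 by auto
  have \<psi>T: "\<psi> u \<in> topspace T" if "norm u \<le> 1" for u
    using \<psi> that by (auto simp: continuous_map_def)
  let ?Z = "blowup_points T \<mu> \<kappa>"
  let ?ZT = "subtopology (prod_topology T euclidean) ?Z"
  have Z: "a \<in> ?Z \<longleftrightarrow> fst a \<in> topspace T \<and> norm (snd a) \<le> 1 \<and> \<mu> (fst a) *\<^sub>R snd a = \<kappa> (fst a)" for a
    by (cases a) (simp add: blowup_points_def)
  have "\<exists>N B. closedin T N \<and> N \<subseteq> V \<and> continuous_map ?ZT T B \<and>
       bij_betw B ?Z (topspace T) \<and> (\<forall>a\<in>?Z. if fst a \<in> N then B a \<in> N else B a = fst a)"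
    if V: "openin T V" "p \<in> V" for V
  proof -
    have "openin (top_of_set (cball 0 1)) {u \<in> topspace (top_of_set (cball 0 1)). \<psi> u \<in> V}"
      by (rule openin_continuous_map_preimage[OF \<psi> V(1)])
    then obtain W where W: "open W" "{u \<in> cball 0 1. \<psi> u \<in> V} = cball 0 1 \<inter> W"
      by (auto simp: openin_open)
    have "0 \<in> {u \<in> cball 0 1. \<psi> u \<in> V}" using V(2) \<psi>0 by simp
    then have "0 \<in> W" unfolding W(2) by simp
    then obtain r where r: "r > 0" "cball 0 r \<subseteq> W" using W(1) open_contains_cball by blast
    \<comment> \<open>At most \<open>r\<close>, to stay inside \<open>V\<close>; at most 1, to stay
      where \<open>\<psi>\<close> inverts \<open>\<kappa>\<close>.\<close>
    define \<delta> where "\<delta> = min 1 r"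
    have \<delta>: "0 < \<delta>" "\<delta> \<le> 1" using r by (auto simp: \<delta>_def)
    have \<delta>V: "\<psi> u \<in> V" if "norm u \<le> \<delta>" for u
    proof -
      have "u \<in> cball 0 1 \<inter> W" using that r(2) by (auto simp: \<delta>_def)
      then show ?thesis using W(2) by blast
    qed
    define N where "N = {z \<in> topspace T. \<mu> z \<in> {..\<delta>}}"
    have cN: "closedin T N"
      unfolding N_def by (rule closedin_continuous_map_preimage[OF \<mu>]) auto
    have NV: "N \<subseteq> V"
    proof
      fix z assume "z \<in> N"
      then have "z \<in> topspace T" "\<mu> z \<le> \<delta>" by (auto simp: N_def)
      then show "z \<in> V" using \<psi>2[of z] \<delta> \<delta>V[of "\<kappa> z"] by simp
    qed
    define b where "b a = ((\<delta> + \<mu> (fst a)) / 2) *\<^sub>R snd a" for a :: "'m \<times> 'e"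
    define B where "B a = (if \<mu> (fst a) \<le> \<delta> then \<psi> (b a) else fst a)" for a
    have nb: "norm (b a) \<le> \<delta>" if "a \<in> ?Z" "\<mu> (fst a) \<le> \<delta>" for a
    proof -
      have "norm (b a) = (\<delta> + \<mu> (fst a)) / 2 * norm (snd a)"
        using \<mu>0[of "fst a"] that \<delta> by (simp add: b_def Z)
      also have "\<dots> \<le> (\<delta> + \<mu> (fst a)) / 2 * 1"
        using \<mu>0[of "fst a"] that \<delta> by (intro mult_left_mono) (auto simp: Z)
      finally show ?thesis using that by simp
    qed
    \<comment> \<open>Near \<open>p\<close>, but not over it, the fibre coordinate is a genuine
      direction: \<open>norm (\<kappa> z) = \<mu> z\<close> makes it a unit vector.\<close>
    have pos: "norm (snd a) = 1" if "a \<in> ?Z" "\<mu> (fst a) \<le> 1" "fst a \<noteq> p" for a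
    proof -
      have "\<mu> (fst a) * norm (snd a) = norm (\<kappa> (fst a))"
        using that(1) \<mu>0[of "fst a"] by (metis Z abs_of_nonneg norm_scaleR)
      also have "\<dots> = \<mu> (fst a)" using \<psi>2[of "fst a"] that by (auto simp: Z)
      finally show ?thesis using \<mu>z[of "fst a"] that by (auto simp: Z)
    qed
    have contZ: "continuous_map ?ZT T fst" "continuous_map ?ZT euclidean snd"
      by (simp_all add: continuous_map_from_subtopology continuous_map_fst continuous_map_snd)
    have cont\<mu>: "continuous_map ?ZT euclideanreal (\<lambda>a. \<mu> (fst a))"
      using continuous_map_compose[OF contZ(1) \<mu>] by (simp add: o_def)
    have contb: "continuous_map ?ZT euclidean b"
      unfolding b_def[abs_def]
      by (intro continuous_map_scaleR contZ(2) continuous_map_real_mult[of _ _ "\<lambda>_. 1 / 2", simplified]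
          continuous_map_add cont\<mu>) auto
    have contB: "continuous_map ?ZT T B"
      unfolding B_def[abs_def]
    proof (rule continuous_map_cases_le[OF cont\<mu>])
      have "continuous_map (subtopology ?ZT {a \<in> topspace ?ZT. \<mu> (fst a) \<le> \<delta>}) (top_of_set (cball 0 1)) b"
        using continuous_map_from_subtopology[OF contb] nb \<delta>
        by (force simp: continuous_map_in_subtopology)
      from continuous_map_compose[OF this \<psi>]
      show "continuous_map (subtopology ?ZT {a \<in> topspace ?ZT. \<mu> (fst a) \<le> \<delta>}) T (\<lambda>a. \<psi> (b a))"
        by (simp add: o_def)
      show "continuous_map (subtopology ?ZT {a \<in> topspace ?ZT. \<delta> \<le> \<mu> (fst a)}) T fst"
        using continuous_map_from_subtopology[OF contZ(1)] .
    next
      \<comment> \<open>On the seam the factor \<open>(\<delta> + \<mu>) / 2\<close> equals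
        \<open>\<mu>\<close>, so \<open>b a\<close> is \<open>\<kappa> (fst a)\<close> and
        \<open>\<psi>\<close> returns the base point.\<close>
      fix a assume a: "a \<in> topspace ?ZT" "\<mu> (fst a) = \<delta>"
      then have "a \<in> ?Z" by auto
      moreover have "b a = \<mu> (fst a) *\<^sub>R snd a" using a by (simp add: b_def)
      ultimately show "\<psi> (b a) = fst a" using \<psi>2[of "fst a"] a(2) \<delta> by (simp add: Z)
    qed simp
    have BN: "B a \<in> N" if "a \<in> ?Z" "fst a \<in> N" for a
      using nb[OF that(1)] that(2) \<psi>1[of "b a"] \<psi>T[of "b a"] \<delta> by (auto simp: N_def B_def)
    have Bid: "B a = fst a" if "a \<in> ?Z" "fst a \<notin> N" for a
      using that by (auto simp: N_def B_def Z)
    have inj: "inj_on B ?Z"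
    proof (rule inj_onI)
      fix a c assume ac: "a \<in> ?Z" "c \<in> ?Z" "B a = B c"
      show "a = c"
      proof (cases "fst a \<in> N")
        case False
        then have cN: "fst c \<notin> N" using BN[OF ac(2)] Bid[OF ac(1)] ac(3) by auto
        then have eq: "fst a = fst c" using Bid ac False by simp
        then have "\<mu> (fst a) *\<^sub>R snd a = \<mu> (fst a) *\<^sub>R snd c" using ac(1,2) by (simp add: Z)
        moreover have "\<mu> (fst a) \<noteq> 0" using False ac(1) \<delta> by (auto simp: N_def Z)
        ultimately show ?thesis using eq by (simp add: prod_eq_iff)
      next
        case True
        then have "fst c \<in> N" using BN[OF ac(1)] Bid[OF ac(2)] ac(3) by metis
        with True have \<mu>le: "\<mu> (fst a) \<le> \<delta>" "\<mu> (fst c) \<le> \<delta>" by (auto simp: N_def)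
        then have "\<psi> (b a) = \<psi> (b c)" using ac(3) by (simp add: B_def)
        moreover have \<kappa>b: "\<kappa> (\<psi> (b x)) = b x" if "x \<in> ?Z" "\<mu> (fst x) \<le> \<delta>" for x
        proof -
          have "norm (b x) \<le> 1" using nb[OF that] \<delta> by linarith
          then show ?thesis using \<psi>1 by blast
        qed
        ultimately have beq: "b a = b c"
          using \<kappa>b[OF ac(1) \<mu>le(1)] \<kappa>b[OF ac(2) \<mu>le(2)] by metis
        have T: "fst a \<in> topspace T" "fst c \<in> topspace T" using ac by (auto simp: Z)
        have n: "norm (b x) = (\<delta> + \<mu> (fst x)) / 2 * norm (snd x)" if "fst x \<in> topspace T" for x
          using \<mu>0[OF that] \<delta> by (simp add: b_def)
        \<comment> \<open>The norm of \<open>b\<close> tells the two cases apart: at most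
          \<open>\<delta> / 2\<close> over \<open>p\<close>, strictly larger elsewhere, where it
          also determines \<open>\<mu>\<close>.\<close>
        have pnt: "norm (b x) \<le> \<delta> / 2" if "x \<in> ?Z" "fst x = p" for x
          using n[of x] that \<mu>p \<delta> p by (simp add: Z)
        have off: "norm (b x) = (\<delta> + \<mu> (fst x)) / 2 \<and> \<mu> (fst x) > 0"
          if "x \<in> ?Z" "\<mu> (fst x) \<le> \<delta>" "fst x \<noteq> p" for x
        proof -
          have "fst x \<in> topspace T" using that(1) by (simp add: Z)
          then show ?thesis
            using n[of x] pos[OF that(1) _ that(3)] that \<delta> \<mu>z[of "fst x"] \<mu>0[of "fst x"] by simp
        qed
        have "fst a = p \<longleftrightarrow> fst c = p"
          using pnt[OF ac(1)] pnt[OF ac(2)] off[OF ac(1) \<mu>le(1)] off[OF ac(2) \<mu>le(2)] beq by force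
        then have \<mu>eq: "\<mu> (fst a) = \<mu> (fst c)"
          using off[OF ac(1) \<mu>le(1)] off[OF ac(2) \<mu>le(2)] beq by force
        then have seq: "snd a = snd c"
          using beq \<delta>(1) \<mu>0[OF T(1)] by (simp add: b_def)
        then have "\<kappa> (fst a) = \<kappa> (fst c)" using \<mu>eq ac(1,2) by (simp add: Z)
        moreover have "\<psi> (\<kappa> (fst a)) = fst a" "\<psi> (\<kappa> (fst c)) = fst c"
          using \<psi>2[OF T(1)] \<psi>2[OF T(2)] \<mu>le \<delta>(2) order_trans by blast+
        ultimately have "fst a = fst c" by metis
        then show ?thesis using seq by (simp add: prod_eq_iff)
      qed
    qed
    have surj: "\<exists>a\<in>?Z. B a = z" if z: "z \<in> topspace T" for z
    proof (cases "\<mu> z \<le> \<delta>")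
      case False
      then have "\<mu> z > 0" using \<delta> by simp
      then have "(z, \<kappa> z /\<^sub>R \<mu> z) \<in> ?Z" using \<mu>\<kappa>[OF z] z by (simp add: Z field_simps)
      moreover have "B (z, \<kappa> z /\<^sub>R \<mu> z) = z" using False by (simp add: B_def)
      ultimately show ?thesis by blast
    next
      case True
      define u where "u = \<kappa> z"
      have u: "\<psi> u = z" "norm u \<le> \<delta>" using \<psi>2[OF z] True \<delta> by (auto simp: u_def)
      show ?thesis
      proof (cases "norm u \<le> \<delta> / 2")
        case True
        \<comment> \<open>The inner half of the ball comes from the fibre over \<open>p\<close>,
          where \<open>b\<close> is multiplication by \<open>\<delta> / 2\<close>.\<close>
        have "\<kappa> p = 0" using \<psi>1[of 0] \<psi>0 by simp
        then have "(p, (2 / \<delta>) *\<^sub>R u) \<in> ?Z" using p True \<mu>p \<delta> by (simp add: Z field_simps)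
        moreover have "B (p, (2 / \<delta>) *\<^sub>R u) = z" using u \<mu>p \<delta> by (simp add: B_def b_def)
        ultimately show ?thesis by blast
      next
        case False
        \<comment> \<open>The solution of \<open>(\<delta> + r) / 2 = norm u\<close>: the point at
          radius \<open>r\<close> in the direction \<open>t\<close> is pushed out to
          \<open>u\<close>.\<close>
        define r where "r = 2 * norm u - \<delta>"
        define t where "t = u /\<^sub>R norm u"
        have u0: "u \<noteq> 0" using False \<delta> by auto
        have r: "0 < r" "r \<le> \<delta>" using False u(2) by (auto simp: r_def)
        have t: "norm t = 1" using u0 by (simp add: t_def)
        have rt: "\<mu> (\<psi> (r *\<^sub>R t)) = r" "\<kappa> (\<psi> (r *\<^sub>R t)) = r *\<^sub>R t"
          using \<psi>1[of "r *\<^sub>R t"] r t \<delta> by auto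
        have "(\<psi> (r *\<^sub>R t), t) \<in> ?Z"
          using rt r t \<delta> \<psi>T[of "r *\<^sub>R t"] by (simp add: Z)
        moreover have "((\<delta> + r) / 2) *\<^sub>R t = u" using u0 by (simp add: r_def t_def)
        then have "B (\<psi> (r *\<^sub>R t), t) = z" using rt r u by (simp add: B_def b_def)
        ultimately show ?thesis by blast
      qed
    qed
    have "B ` ?Z = topspace T"
    proof (intro equalityI subsetI)
      fix z assume "z \<in> B ` ?Z"
      then obtain a where a: "z = B a" "a \<in> ?Z" by (rule imageE)
      then show "z \<in> topspace T"
        using BN[OF a(2)] Bid[OF a(2)] by (cases "fst a \<in> N") (auto simp: N_def Z)
    qed (use surj in force)
    then have "bij_betw B ?Z (topspace T)" using inj by (simp add: bij_betw_def)
    then show ?thesis using cN NV contB BN Bid by (intro exI[of _ N] exI[of _ B]) auto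
  qed
  then show ?thesis
    using p \<mu> \<kappa> \<mu>0 \<mu>z \<mu>\<kappa> unfolding blowup_model_def by blast
qed

text \<open>Centred and rescaled chart coordinates \<open>\<xi>\<close> serve as
  \<open>\<kappa>\<close> on the unit ball, with their norm as \<open>\<mu>\<close>. The shell
  between radius 1 and 2 is used to extend both continuously to the whole space.\<close>

lemma chart_imp_blowup_model:
  fixes \<phi> :: "'m \<Rightarrow> 'e::euclidean_space"
  assumes haus: "Hausdorff_space T" and U: "openin T U" "y \<in> U" and op: "open (\<phi> ` U)"
    and hom: "homeomorphic_map (subtopology T U) (top_of_set (\<phi> ` U)) \<phi>"
  obtains \<mu> and \<kappa> :: "'m \<Rightarrow> 'e" where "blowup_model T y \<mu> \<kappa>"
    "\<And>z. z \<in> topspace T \<Longrightarrow> \<mu> z \<le> 1 \<Longrightarrow> norm (\<kappa> z) = \<mu> z"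
proof -
  have UT: "U \<subseteq> topspace T" using U openin_subset by blast
  obtain \<phi>' where "homeomorphic_maps (subtopology T U) (top_of_set (\<phi> ` U)) \<phi> \<phi>'"
    using hom homeomorphic_map_maps by blast
  then have cont\<phi>: "continuous_map (subtopology T U) euclidean \<phi>"
    and cont\<phi>': "continuous_map (top_of_set (\<phi> ` U)) (subtopology T U) \<phi>'"
    and inv\<phi>: "\<And>z. z \<in> U \<Longrightarrow> \<phi>' (\<phi> z) = z"
    using UT by (auto simp: homeomorphic_maps_def continuous_map_in_subtopology)
  obtain r where r: "r > 0" "cball (\<phi> y) r \<subseteq> \<phi> ` U"
    using op U(2) by (meson image_eqI open_contains_cball)
  \<comment> \<open>With half the radius, the ball of radius 2 in rescaled coordinates still lies in
    the chart image.\<close>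
  define s where "s = r / 2"
  have s: "s > 0" using r by (simp add: s_def)
  define \<xi> where "\<xi> z = (\<phi> z - \<phi> y) /\<^sub>R s" for z
  define \<psi> where "\<psi> u = \<phi>' (\<phi> y + s *\<^sub>R u)" for u
  have img: "\<phi> y + s *\<^sub>R u \<in> \<phi> ` U" if "norm u \<le> 2" for u
  proof -
    have "dist (\<phi> y) (\<phi> y + s *\<^sub>R u) \<le> r" using that s by (simp add: dist_norm s_def)
    then show ?thesis using r(2) by auto
  qed
  have \<psi>: "\<psi> u \<in> U" "\<xi> (\<psi> u) = u" if u: "norm u \<le> 2" for u
  proof -
    obtain z where z: "z \<in> U" "\<phi> y + s *\<^sub>R u = \<phi> z" using img[OF u] by auto
    then have "\<psi> u = z" by (simp add: \<psi>_def inv\<phi>)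
    moreover have "\<phi> z - \<phi> y = s *\<^sub>R u" using z(2) by (simp add: algebra_simps flip: z(2))
    ultimately show "\<psi> u \<in> U" "\<xi> (\<psi> u) = u" using z(1) s by (auto simp: \<xi>_def)
  qed
  have \<psi>\<xi>: "\<psi> (\<xi> z) = z" if "z \<in> U" for z
    using that s inv\<phi> by (simp add: \<psi>_def \<xi>_def)
  have cont\<xi>: "continuous_map (subtopology T U) euclidean \<xi>"
    unfolding \<xi>_def[abs_def] by (intro continuous_map_scaleR continuous_map_diff cont\<phi>) auto
  have cont\<psi>: "continuous_map (top_of_set (cball 0 2)) T \<psi>"
  proof -
    have "continuous_map (top_of_set (cball 0 2)) (top_of_set (\<phi> ` U)) (\<lambda>u. \<phi> y + s *\<^sub>R u)"
      using img by (auto simp: continuous_map_in_subtopology intro!: continuous_intros)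
    from continuous_map_compose[OF this cont\<phi>'] show ?thesis
      by (simp add: o_def \<psi>_def[abs_def] continuous_map_in_subtopology)
  qed
  have "compactin (top_of_set (cball 0 2)) (cball 0 2 :: 'e set)"
    by (simp add: compactin_subtopology)
  \<comment> \<open>Compact in a Hausdorff space, hence closed: its complement and \<open>U\<close>
    are the two open sets used for pasting below.\<close>
  then have cD: "closedin T (\<psi> ` cball 0 2)"
    using image_compactin[OF _ cont\<psi>] compactin_imp_closedin haus by blast
  have outside: "norm (\<xi> z) > 2" if "z \<in> U" "z \<notin> \<psi> ` cball 0 2" for z
    using that \<psi>\<xi>[OF that(1)] by (metis image_eqI linorder_not_less mem_cball_0)
  define G where "G = {z \<in> U. norm (\<xi> z) < 2}"
  define \<mu> where "\<mu> z = (if z \<in> G then norm (\<xi> z) else 2)" for z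
  \<comment> \<open>The factor is 1 up to radius 1 and tapers to 0 at radius 2, so the extension by
    0 is continuous; never exceeding 1, it keeps
    \<open>norm (\<kappa> z) \<le> \<mu> z\<close>.\<close>
  define \<kappa> where "\<kappa> z = (if z \<in> G then min 1 (2 - norm (\<xi> z)) *\<^sub>R \<xi> z else 0)" for z
  have paste: "continuous_map T euclidean f"
    if g: "continuous_map (subtopology T U) euclidean g"
      and fg: "\<And>z. z \<in> U \<Longrightarrow> f z = g z" and fc: "\<And>z. z \<notin> G \<Longrightarrow> f z = c"
    for f g :: "'m \<Rightarrow> 'x::topological_space" and c
  proof (rule pasting_lemma[of "{True, False}" T "\<lambda>i. if i then U else topspace T - \<psi> ` cball 0 2" _
        "\<lambda>i. if i then g else (\<lambda>_. c)"])
    show "openin T (if i then U else topspace T - \<psi> ` cball 0 2)" for i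
      using U(1) cD by auto
    show "continuous_map (subtopology T (if i then U else topspace T - \<psi> ` cball 0 2)) euclidean
       (if i then g else (\<lambda>_. c))" for i
      using g by auto
    have "g z = c" if "z \<in> U" "z \<notin> \<psi> ` cball 0 2" for z
      using outside[OF that] fg[of z] fc[of z] that(1) by (auto simp: G_def)
    then show "(if i then g else (\<lambda>_. c)) z = (if j then g else (\<lambda>_. c)) z"
      if "z \<in> topspace T \<inter> (if i then U else topspace T - \<psi> ` cball 0 2) \<inter>
        (if j then U else topspace T - \<psi> ` cball 0 2)" for i j z
      using that by (cases i; cases j) auto
    show "\<exists>j. j \<in> {True, False} \<and> z \<in> (if j then U else topspace T - \<psi> ` cball 0 2) \<and>
        f z = (if j then g else (\<lambda>_. c)) z" if "z \<in> topspace T" for z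
    proof (cases "z \<in> U")
      case True
      then show ?thesis using fg by (intro exI[of _ True]) auto
    next
      case False
      then have "z \<notin> \<psi> ` cball 0 2" "z \<notin> G" using \<psi>(1) by (auto simp: G_def)
      then show ?thesis using fc that by (intro exI[of _ False]) auto
    qed
  qed
  have cont\<mu>: "continuous_map T euclideanreal \<mu>"
    by (rule paste[of "\<lambda>z. min (norm (\<xi> z)) 2" _ 2])
      (auto simp: \<mu>_def G_def intro!: continuous_map_real_min continuous_map_norm cont\<xi>)
  have cont\<kappa>: "continuous_map T euclidean \<kappa>"
    by (rule paste[of "\<lambda>z. max 0 (min 1 (2 - norm (\<xi> z))) *\<^sub>R \<xi> z" _ 0])
      (auto simp: \<kappa>_def G_def intro!: continuous_map_scaleR continuous_map_real_max
        continuous_map_real_min continuous_map_diff continuous_map_norm cont\<xi>)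
  have \<psi>1: "\<kappa> (\<psi> u) = u \<and> \<mu> (\<psi> u) = norm u" if "norm u \<le> 1" for u
    using \<psi>[of u] that by (auto simp: \<kappa>_def \<mu>_def G_def)
  have \<psi>2: "\<psi> (\<kappa> z) = z \<and> norm (\<kappa> z) = \<mu> z" if "\<mu> z \<le> 1" for z
    using that \<psi>\<xi>[of z] by (auto simp: \<kappa>_def \<mu>_def G_def split: if_splits)
  have "\<xi> y = 0" by (simp add: \<xi>_def)
  then have \<psi>0: "\<psi> 0 = y" using \<psi>\<xi>[OF U(2)] by simp
  have \<mu>\<kappa>: "norm (\<kappa> z) \<le> \<mu> z" for z
    using mult_right_mono[of "2 - norm (\<xi> z)" 1 "norm (\<xi> z)"]
    by (auto simp: \<kappa>_def \<mu>_def G_def min_def)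
  have "blowup_model T y \<mu> \<kappa>"
  proof (rule blowup_modelI[OF _ cont\<mu> cont\<kappa> _ \<mu>\<kappa> \<psi>1 \<psi>2 \<psi>0])
    show "continuous_map (top_of_set (cball 0 1)) T \<psi>"
      by (rule continuous_map_from_subtopology_mono[OF cont\<psi>]) auto
  qed (use UT U in auto)
  then show thesis using that \<psi>2 by blast
qed

section \<open>Neighbourhoods in the space of actions\<close>

text \<open>The inverse of \<open>f g\<close> is \<open>f\<close> at the inverse of
  \<open>g\<close>, so continuity of all the maps already makes them homeomorphisms.\<close>

lemma C0_actionsI:
  assumes G: "group G"
    and cont: "\<And>g. g \<in> carrier G \<Longrightarrow> continuous_map T T (f g)"
    and one: "\<And>x. x \<in> topspace T \<Longrightarrow> f \<one>\<^bsub>G\<^esub> x = x"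
    and mult: "\<And>g h x. g \<in> carrier G \<Longrightarrow> h \<in> carrier G \<Longrightarrow> x \<in> topspace T \<Longrightarrow>
      f (g \<otimes>\<^bsub>G\<^esub> h) x = f g (f h x)"
  shows "(\<lambda>g\<in>carrier G. restrict (f g) (topspace T)) \<in> C0_actions G T"
proof -
  interpret group G by fact
  let ?F = "\<lambda>g\<in>carrier G. restrict (f g) (topspace T)"
  have fT: "f g x \<in> topspace T" if "g \<in> carrier G" "x \<in> topspace T" for g x
    using cont[OF that(1)] that(2) by (auto simp: continuous_map_def)
  have inv: "f (inv\<^bsub>G\<^esub> g) (f g x) = x" "f g (f (inv\<^bsub>G\<^esub> g) x) = x"
    if "g \<in> carrier G" "x \<in> topspace T" for g x
    using mult[of "inv\<^bsub>G\<^esub> g" g x] mult[of g "inv\<^bsub>G\<^esub> g" x] one[OF that(2)] that by simp_all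
  have "homeomorphic_maps T T (?F g) (?F (inv\<^bsub>G\<^esub> g))" if g: "g \<in> carrier G" for g
    unfolding homeomorphic_maps_def
    using g inv fT by (auto intro: continuous_map_eq[OF cont])
  then have hom: "homeomorphic_map T T (?F g)" if "g \<in> carrier G" for g
    using that homeomorphic_map_maps by blast
  then have bij: "?F g \<in> Bij (topspace T)" if "g \<in> carrier G" for g
    using that homeomorphic_eq_everything_map[of T T "?F g"] by (simp add: Bij_def bij_betw_def)
  have "?F (g \<otimes>\<^bsub>G\<^esub> h) = compose (topspace T) (?F g) (?F h)"
    if "g \<in> carrier G" "h \<in> carrier G" for g h
    using that mult fT by (auto simp: compose_def fun_eq_iff)
  then have "?F \<in> hom G (BijGroup (topspace T))"
    using bij by (auto simp: hom_def BijGroup_def)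
  then have "group_action G (topspace T) ?F"
    unfolding group_action_def group_hom_def group_hom_axioms_def
    using G group_BijGroup by blast
  moreover have "?F \<in> carrier G \<rightarrow>\<^sub>E Homeo T"
    using hom by (auto simp: Homeo_def)
  ultimately show ?thesis by (simp add: C0_actions_def)
qed

context Metric_space
begin

lemma compact_open_nbhd:
  assumes U: "openin (compact_open_topology mtopology) U"
    and f: "f \<in> U"
  shows "\<exists>\<epsilon>>0. \<forall>f'\<in>Homeo mtopology. (\<forall>x\<in>M. d (f x) (f' x) < \<epsilon>) \<longrightarrow> f' \<in> U"
proof -
  have "f \<in> Homeo mtopology"
    using openin_subset[OF U] f topspace_compact_open_topology by blast
  then have contf: "continuous_map mtopology mtopology f"
    unfolding Homeo_def using homeomorphic_imp_continuous_map by blast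
  have "generate_topology_on {{f \<in> Homeo mtopology. f ` K \<subseteq> U} |K U.
      compactin mtopology K \<and> openin mtopology U} U"
    using U unfolding compact_open_topology_def openin_topology_generated_by_iff .
  then show ?thesis using f
  proof (induction rule: generate_topology_on.induct)
    case (Int a b)
    then obtain e e' where "e > 0" "\<forall>f'\<in>Homeo mtopology. (\<forall>x\<in>M. d (f x) (f' x) < e) \<longrightarrow> f' \<in> a"
      "e' > 0" "\<forall>f'\<in>Homeo mtopology. (\<forall>x\<in>M. d (f x) (f' x) < e') \<longrightarrow> f' \<in> b" by blast
    then show ?case by (intro exI[of _ "min e e'"]) auto
  next
    case (UN K)
    then obtain k where "k \<in> K" "f \<in> k" by blast
    then show ?case using UN.IH by blast
  next
    case (Basis s)
    then obtain K V where s: "s = {f \<in> Homeo mtopology. f ` K \<subseteq> V}"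
      and K: "compactin mtopology K" and V: "openin mtopology V" by blast
    have fK: "compactin mtopology (f ` K)" by (rule image_compactin[OF K contf])
    have fV: "f ` K \<subseteq> V" using Basis.prems s by blast
    obtain \<epsilon> where \<epsilon>: "\<epsilon> > 0" "\<And>x. x \<in> f ` K \<Longrightarrow> \<exists>U\<in>{V}. mball x \<epsilon> \<subseteq> U"
      using lebesgue_number[OF fK, of "{V}"] fV V by auto
    have "f' \<in> s" if f': "f' \<in> Homeo mtopology" "\<forall>x\<in>M. d (f x) (f' x) < \<epsilon>" for f'
    proof -
      have "f' x \<in> V" if x: "x \<in> K" for x
      proof -
        have xM: "x \<in> M" using compactin_subset_topspace[OF K] x by auto
        have "f' ` M = M" using f'(1) homeomorphic_imp_surjective_map unfolding Homeo_def by fastforce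
        then have "f' x \<in> M" using xM by blast
        moreover have "f x \<in> M" using contf xM by (auto simp: continuous_map_def)
        ultimately have "f' x \<in> mball (f x) \<epsilon>" using f'(2) xM by simp
        then show ?thesis using \<epsilon>(2)[of "f x"] x by blast
      qed
      then show ?thesis using f'(1) s by blast
    qed
    then show ?case using \<epsilon>(1) by blast
  qed simp
qed

text \<open>A basic set of the product topology constrains only finitely many group elements, so one
  minimal radius serves them all.\<close>

lemma action_topology_nbhd:
  assumes W: "openin (action_topology G mtopology) W" "\<rho> \<in> W"
  shows "\<exists>F \<epsilon>. finite F \<and> F \<subseteq> carrier G \<and> \<epsilon> > 0 \<and>
    (\<forall>\<rho>'\<in>C0_actions G mtopology. (\<forall>g\<in>F. \<forall>x\<in>M. d (\<rho> g x) (\<rho>' g x) < \<epsilon>) \<longrightarrow> \<rho>' \<in> W)"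
proof -
  let ?T = "compact_open_topology mtopology"
  obtain W' where W': "openin (product_topology (\<lambda>_. ?T) (carrier G)) W'"
      "W = W' \<inter> C0_actions G mtopology"
    using W(1) unfolding action_topology_def openin_subtopology by blast
  then have "\<rho> \<in> W'" using W(2) by simp
  from product_topology_open_contains_basis[OF W'(1) this] obtain U where
    "\<rho> \<in> (\<Pi>\<^sub>E g\<in>carrier G. U g) \<and> (\<forall>g. openin ?T (U g)) \<and>
      finite {g. U g \<noteq> topspace ?T} \<and> (\<Pi>\<^sub>E g\<in>carrier G. U g) \<subseteq> W'" ..
  then have U: "\<rho> \<in> (\<Pi>\<^sub>E g\<in>carrier G. U g)" "\<And>g. openin ?T (U g)"
      "finite {g. U g \<noteq> topspace ?T}" "(\<Pi>\<^sub>E g\<in>carrier G. U g) \<subseteq> W'" by simp_all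
  define F where "F = {g. U g \<noteq> topspace ?T} \<inter> carrier G"
  have F: "finite F" "F \<subseteq> carrier G" using U(3) by (auto simp: F_def)
  have "\<forall>g\<in>F. \<exists>\<epsilon>>0. \<forall>f'\<in>Homeo mtopology. (\<forall>x\<in>M. d (\<rho> g x) (f' x) < \<epsilon>) \<longrightarrow> f' \<in> U g"
    using compact_open_nbhd[OF U(2)] U(1) F(2) by (auto simp: PiE_iff)
  from bchoice[OF this] obtain e where e: "\<And>g. g \<in> F \<Longrightarrow> e g > 0"
    "\<And>g f'. g \<in> F \<Longrightarrow> f' \<in> Homeo mtopology \<Longrightarrow> (\<forall>x\<in>M. d (\<rho> g x) (f' x) < e g) \<Longrightarrow> f' \<in> U g"
    by blast
  \<comment> \<open>The extra 1 keeps \<open>Min\<close> meaningful when \<open>F\<close> is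
    empty.\<close>
  define \<epsilon> where "\<epsilon> = Min (insert 1 (e ` F))"
  have \<epsilon>: "\<epsilon> > 0" "\<And>g. g \<in> F \<Longrightarrow> \<epsilon> \<le> e g"
    using F(1) e(1) by (auto simp: \<epsilon>_def)
  have "\<rho>' \<in> W" if \<rho>': "\<rho>' \<in> C0_actions G mtopology" "\<forall>g\<in>F. \<forall>x\<in>M. d (\<rho> g x) (\<rho>' g x) < \<epsilon>" for \<rho>'
  proof -
    have E: "\<rho>' \<in> carrier G \<rightarrow>\<^sub>E Homeo mtopology" using \<rho>'(1) by (simp add: C0_actions_def)
    have "\<rho>' g \<in> U g" if g: "g \<in> carrier G" for g
    proof (cases "g \<in> F")
      case True
      have "\<forall>x\<in>M. d (\<rho> g x) (\<rho>' g x) < e g"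
        using \<rho>'(2) \<epsilon>(2)[OF True] True by (meson less_le_trans)
      then show ?thesis using e(2)[OF True] PiE_mem[OF E g] by blast
    next
      case False
      then have "U g = Homeo mtopology" using g by (auto simp: F_def topspace_compact_open_topology)
      then show ?thesis using PiE_mem[OF E g] by simp
    qed
    then have "\<rho>' \<in> (\<Pi>\<^sub>E g\<in>carrier G. U g)" using E by (simp add: PiE_iff)
    then have "\<rho>' \<in> W'" using U(4) by blast
    then show ?thesis using W'(2) \<rho>'(1) by blast
  qed
  then show ?thesis using F \<epsilon>(1) by blast
qed

end

section \<open>Lifting an action to the blow-up\<close>

text \<open>\<open>unit\<close> makes the coordinates near the fibre over \<open>y\<close> unit
  vectors, so that the interior of the ball there is open in the blow-up.
  \<open>stabilizer_germ\<close> makes the transported models agree as germs, whichever group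
  element transports them.\<close>

locale action_blowup = Metric_space M d + group_action G M \<rho>
  for M :: "'m set" and d and G (structure) and \<rho> +
  fixes y :: 'm and \<mu>\<^sub>0 :: "'m \<Rightarrow> real" and \<kappa>\<^sub>0 :: "'m \<Rightarrow> 'e::euclidean_space"
  assumes compact_M: "compact_space mtopology"
    and countable_G: "countable (carrier G)"
    and continuous: "\<And>g. g \<in> carrier G \<Longrightarrow> continuous_map mtopology mtopology (\<rho> g)"
    and base_model: "blowup_model mtopology y \<mu>\<^sub>0 \<kappa>\<^sub>0"
    and unit: "\<And>z. z \<in> M \<Longrightarrow> \<mu>\<^sub>0 z \<le> 1 \<Longrightarrow> norm (\<kappa>\<^sub>0 z) = \<mu>\<^sub>0 z"
    and stabilizer_germ: "\<And>s. s \<in> carrier G \<Longrightarrow> \<rho> s y = y \<Longrightarrow>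
      \<exists>U. openin mtopology U \<and> y \<in> U \<and> (\<forall>z\<in>U. \<rho> s z = z)"
begin

sublocale group G
  using group_hom group_hom.axioms(1) by blast

lemma y_in: "y \<in> M"
  using base_model by (simp add: blowup_model_def)

lemma \<rho>_in: "g \<in> carrier G \<Longrightarrow> z \<in> M \<Longrightarrow> \<rho> g z \<in> M"
  using element_image by blast

lemma \<rho>_one: "z \<in> M \<Longrightarrow> \<rho> \<one> z = z"
  using id_eq_one by (metis restrict_apply')

lemma \<rho>_inv: "g \<in> carrier G \<Longrightarrow> z \<in> M \<Longrightarrow> \<rho> (inv g) (\<rho> g z) = z"
  "g \<in> carrier G \<Longrightarrow> z \<in> M \<Longrightarrow> \<rho> g (\<rho> (inv g) z) = z"
  using composition_rule[of z "inv g" g] composition_rule[of z g "inv g"] \<rho>_one by simp_all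

text \<open>An arbitrary coset representative for each orbit point; \<open>pull_local\<close> shows
  that the choice does not affect germs.\<close>

definition transporter :: "'m \<Rightarrow> 'a" where
  "transporter p = (SOME g. g \<in> carrier G \<and> \<rho> g y = p)"

lemma transporter:
  assumes "p \<in> orbit G \<rho> y"
  shows "transporter p \<in> carrier G" "\<rho> (transporter p) y = p"
proof -
  have "\<exists>g. g \<in> carrier G \<and> \<rho> g y = p" using assms by (auto simp: orbit_def)
  then show "transporter p \<in> carrier G" "\<rho> (transporter p) y = p"
    unfolding transporter_def by (metis (mono_tags, lifting) someI_ex)+
qed

definition pull :: "'m \<Rightarrow> 'm \<Rightarrow> 'm" where
  "pull p = \<rho> (inv (transporter p))"

lemma orbit_action:
  assumes "g \<in> carrier G" "p \<in> orbit G \<rho> y"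
  shows "\<rho> g p \<in> orbit G \<rho> y"
proof -
  obtain h where "h \<in> carrier G" "p = \<rho> h y" using assms(2) by (auto simp: orbit_def)
  then have "\<rho> g p = \<rho> (g \<otimes> h) y" "g \<otimes> h \<in> carrier G"
    using assms(1) composition_rule[OF y_in] by simp_all
  then show ?thesis unfolding orbit_def by blast
qed

lemma orbit_action_iff:
  assumes "g \<in> carrier G" "z \<in> M"
  shows "\<rho> g z \<in> orbit G \<rho> y \<longleftrightarrow> z \<in> orbit G \<rho> y"
  using orbit_action[OF assms(1)] orbit_action[of "inv g" "\<rho> g z"] \<rho>_inv[OF assms] assms by auto

sublocale blowup M d "orbit G \<rho> y" "\<lambda>p. \<mu>\<^sub>0 \<circ> pull p" "\<lambda>p. \<kappa>\<^sub>0 \<circ> pull p"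
proof
  show "countable (orbit G \<rho> y)"
    using countable_G unfolding orbit_def by (simp add: setcompr_eq_image)
  show "orbit G \<rho> y \<noteq> {}" using orbit_refl[OF y_in] by blast
  fix p assume p: "p \<in> orbit G \<rho> y"
  have "homeomorphic_maps mtopology mtopology (\<rho> (transporter p)) (pull p)"
    unfolding homeomorphic_maps_def pull_def
    using continuous transporter(1)[OF p] \<rho>_inv by simp
  from blowup_model_transport[OF base_model this]
  show "blowup_model mtopology p (\<mu>\<^sub>0 \<circ> pull p) (\<kappa>\<^sub>0 \<circ> pull p)"
    by (simp add: transporter(2)[OF p])
qed (rule compact_M)

text \<open>With \<open>h\<close> and \<open>k\<close> the transporters of \<open>p\<close> and
  \<open>\<rho> g p\<close>, the element \<open>s = inv k \<otimes> (g \<otimes> h)\<close> fixes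
  \<open>y\<close> and hence is the identity near \<open>y\<close>. Read off near \<open>p\<close>,
  this is the claimed equality.\<close>

lemma pull_local:
  assumes g: "g \<in> carrier G" and p: "p \<in> orbit G \<rho> y"
  shows "\<exists>U. openin mtopology U \<and> p \<in> U \<and> (\<forall>z\<in>U. pull (\<rho> g p) (\<rho> g z) = pull p z)"
proof -
  let ?h = "transporter p" and ?k = "transporter (\<rho> g p)"
  have h: "?h \<in> carrier G" "\<rho> ?h y = p" and k: "?k \<in> carrier G" "\<rho> ?k y = \<rho> g p"
    using transporter[OF p] transporter[OF orbit_action[OF g p]] by auto
  have pM: "p \<in> M" using subsetD[OF P_subset p] .
  define s where "s = inv ?k \<otimes> (g \<otimes> ?h)"
  have s: "s \<in> carrier G" using g h k by (simp add: s_def)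
  have \<rho>s: "\<rho> s w = \<rho> (inv ?k) (\<rho> g (\<rho> ?h w))" if "w \<in> M" for w
    using that g h(1) k(1) by (simp add: s_def composition_rule \<rho>_in)
  have "\<rho> s y = y" using \<rho>s[OF y_in] h(2) k \<rho>_inv(1)[OF k(1) y_in] by simp
  from stabilizer_germ[OF s this] obtain U
    where U: "openin mtopology U" "y \<in> U" "\<And>z. z \<in> U \<Longrightarrow> \<rho> s z = z" by blast
  let ?V = "{z \<in> topspace mtopology. \<rho> (inv ?h) z \<in> U}"
  have "openin mtopology ?V"
    using openin_continuous_map_preimage[OF continuous U(1)] h(1) by simp
  moreover have "p \<in> ?V" using pM \<rho>_inv(1)[OF h(1) y_in] h(2) U(2) by simp
  moreover have "pull (\<rho> g p) (\<rho> g z) = pull p z" if "z \<in> ?V" for z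
  proof -
    have z: "z \<in> M" "\<rho> (inv ?h) z \<in> U" using that by auto
    have "\<rho> s (\<rho> (inv ?h) z) = \<rho> (inv ?h) z" using U(3) z(2) by blast
    then show ?thesis
      using \<rho>s[OF \<rho>_in[OF inv_closed[OF h(1)] z(1)]] \<rho>_inv(2)[OF h(1) z(1)] by (simp add: pull_def)
  qed
  ultimately show ?thesis by blast
qed

text \<open>The default 0 off the orbit lets base point and \<open>fibre\<close> together determine
  every point, and makes \<open>fibre\<close> invariant under the lifted action everywhere.\<close>

definition fibre :: "'m \<times> ('m \<Rightarrow> 'e) \<Rightarrow> 'e" where
  "fibre a = (if fst a \<in> orbit G \<rho> y then snd a (fst a) else 0)"

definition lifted :: "'a \<Rightarrow> 'm \<times> ('m \<Rightarrow> 'e) \<Rightarrow> 'm \<times> ('m \<Rightarrow> 'e)" where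
  "lifted g a = lift (\<rho> g (fst a)) (fibre a)"

lemma norm_fibre: "a \<in> points \<Longrightarrow> norm (fibre a) \<le> 1"
  using norm_coordinate by (simp add: fibre_def)

lemma points_eq_fibreI:
  assumes "a \<in> points" "b \<in> points" "fst a = fst b" "fibre a = fibre b"
  shows "a = b"
  using assms by (intro points_eqI) (auto simp: fibre_def)

lemma lifted_in [simp]: "g \<in> carrier G \<Longrightarrow> a \<in> points \<Longrightarrow> lifted g a \<in> points"
  unfolding lifted_def using norm_fibre \<rho>_in by simp

lemma fst_lifted [simp]: "fst (lifted g a) = \<rho> g (fst a)"
  by (simp add: lifted_def)

lemma fibre_lifted:
  assumes "g \<in> carrier G" "a \<in> points"
  shows "fibre (lifted g a) = fibre a"
  using orbit_action_iff[OF assms(1) fst_in[OF assms(2)]] by (simp add: fibre_def lifted_def)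

lemma lifted_one: "a \<in> points \<Longrightarrow> lifted \<one> a = a"
  by (rule points_eq_fibreI) (simp_all add: \<rho>_one fibre_lifted)

lemma lifted_mult:
  "g \<in> carrier G \<Longrightarrow> h \<in> carrier G \<Longrightarrow> a \<in> points \<Longrightarrow> lifted (g \<otimes> h) a = lifted g (lifted h a)"
  by (rule points_eq_fibreI) (simp_all add: composition_rule fibre_lifted)

text \<open>
  Near the fibre over \<open>p\<close> the coordinates at \<open>p\<close> and at \<open>\<rho> g p\<close> agree, because all
  stabilizer elements of \<open>y\<close> have trivial germ there.
\<close>

lemma continuous_map_lifted:
  assumes g: "g \<in> carrier G"
  shows "continuous_map blowup_top blowup_top (lifted g)"
proof (rule continuous_map_into_blowup)
  have fstc: "continuous_map blowup_top mtopology (\<lambda>a. \<rho> g (fst a))"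
    using continuous_map_compose[OF continuous_map_blowup_fst continuous[OF g]] by (simp add: o_def)
  then show "continuous_map blowup_top mtopology (\<lambda>a. fst (lifted g a))" by simp
  show "lifted g ` topspace blowup_top \<subseteq> points" using g by auto
  fix q assume q: "q \<in> orbit G \<rho> y"
  define p where "p = \<rho> (inv g) q"
  have qM: "q \<in> M" using q P_subset by blast
  have p: "p \<in> orbit G \<rho> y" "\<rho> g p = q" "p \<in> M"
    using orbit_action[of "inv g" q] \<rho>_inv(2)[OF g qM] g q qM \<rho>_in by (auto simp: p_def)
  obtain U where U: "openin mtopology U" "p \<in> U" "\<And>z. z \<in> U \<Longrightarrow> pull q (\<rho> g z) = pull p z"
    using pull_local[OF g p(1)] p(2) by auto
  \<comment> \<open>One piece contains the fibre over \<open>p\<close>, where a coordinate of the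
    argument is simply copied; on the other, \<open>\<mu>\<^sub>0\<close> has no zero and the
    quotient formula is continuous.\<close>
  let ?T = "\<lambda>i. {a \<in> topspace blowup_top. fst a \<in> (if i then U else M - {p})}"
  let ?r = "\<lambda>a. \<kappa>\<^sub>0 (pull q (\<rho> g (fst a))) /\<^sub>R \<mu>\<^sub>0 (pull q (\<rho> g (fst a)))"
  have off: "\<rho> g (fst a) \<noteq> q" if "a \<in> points" "fst a \<noteq> p" for a
    using that \<rho>_inv(1)[OF g fst_in[OF that(1)]] by (auto simp: p_def)
  have coord: "snd (lifted g a) q = ?r a" if "a \<in> points" "fst a \<noteq> p" for a
    using coordinate_off_point[OF lifted_in[OF g that(1)] q] off[OF that] by simp
  have coordU: "snd (lifted g a) q = snd a p" if a: "a \<in> points" "fst a \<in> U" for a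
  proof (cases "fst a = p")
    case True
    then show ?thesis using p q by (simp add: lifted_def fibre_def lift_def)
  next
    case False
    then show ?thesis
      using coord[OF a(1) False] U(3)[OF a(2)] coordinate_off_point[OF a(1) p(1) False] by simp
  qed
  show "continuous_map blowup_top euclidean (\<lambda>a. snd (lifted g a) q)"
  proof (rule pasting_lemma[of "{True, False}" blowup_top ?T _ "\<lambda>i. if i then (\<lambda>a. snd a p) else ?r"])
    have "openin mtopology (M - {p})"
      using closedin_Hausdorff_singleton[OF Hausdorff_space_mtopology, of p] p(3)
      by (simp add: closedin_def)
    then have "openin mtopology (if i then U else M - {p})" for i using U(1) by simp
    then show "openin blowup_top (?T i)" for i
      by (rule openin_continuous_map_preimage[OF continuous_map_blowup_fst])
    have m: "continuous_map mtopology euclideanreal (\<mu>\<^sub>0 \<circ> pull q)"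
      "continuous_map mtopology euclidean (\<kappa>\<^sub>0 \<circ> pull q)"
      using model[OF q] by (simp_all add: blowup_model_def)
    have "continuous_map (subtopology blowup_top (?T False)) euclidean ?r"
    proof (intro continuous_map_scaleR continuous_map_real_inverse)
      show "continuous_map (subtopology blowup_top (?T False)) euclideanreal (\<lambda>a. \<mu>\<^sub>0 (pull q (\<rho> g (fst a))))"
        "continuous_map (subtopology blowup_top (?T False)) euclidean (\<lambda>a. \<kappa>\<^sub>0 (pull q (\<rho> g (fst a))))"
        using continuous_map_compose[OF continuous_map_from_subtopology[OF fstc] m(1)]
          continuous_map_compose[OF continuous_map_from_subtopology[OF fstc] m(2)] by (simp_all add: o_def)
      fix a assume "a \<in> topspace (subtopology blowup_top (?T False))"
      then have "a \<in> points" "fst a \<noteq> p" by auto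
      then show "\<mu>\<^sub>0 (pull q (\<rho> g (fst a))) \<noteq> 0"
        using \<mu>_zero_iff[OF q \<rho>_in[OF g fst_in]] off by simp
    qed
    moreover have "continuous_map (subtopology blowup_top (?T True)) euclidean (\<lambda>a. snd a p)"
      by (rule continuous_map_from_subtopology[OF continuous_map_coordinate[OF p(1)]])
    ultimately show "continuous_map (subtopology blowup_top (?T i)) euclidean
        (if i then (\<lambda>a. snd a p) else ?r)" for i
      by (cases i) simp_all
  next
    fix i j :: bool and a assume "a \<in> topspace blowup_top \<inter> ?T i \<inter> ?T j"
    then show "(if i then (\<lambda>a. snd a p) else ?r) a = (if j then (\<lambda>a. snd a p) else ?r) a"
      using coord[of a] coordU[of a] by (cases i; cases j) auto
  next
    fix a assume a: "a \<in> topspace blowup_top"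
    show "\<exists>j. j \<in> {True, False} \<and> a \<in> ?T j \<and>
        snd (lifted g a) q = (if j then (\<lambda>a. snd a p) else ?r) a"
      using a coord[of a] coordU[of a] U(2) by (intro exI[of _ "fst a = p"]) auto
  qed
qed

text \<open>An orbit of the lifted action meets the fibre over \<open>y\<close> in at most one point.\<close>

lemma lifted_orbit_misses:
  assumes a: "a \<in> points"
  obtains V where "openin blowup_top V" "V \<noteq> {}" "\<And>g. g \<in> carrier G \<Longrightarrow> lifted g a \<notin> V"
proof -
  have yo: "y \<in> orbit G \<rho> y" by (rule orbit_refl[OF y_in])
  let ?m = "\<lambda>b. (\<mu>\<^sub>0 \<circ> pull y) (fst b)"
  \<comment> \<open>Where \<open>\<mu>\<^sub>0\<close> is below 1, points not over \<open>y\<close>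
    have a coordinate of norm exactly 1, so the open ball condition leaves only points over
    \<open>y\<close>. There the orbit of \<open>a\<close> could contribute only
    \<open>fibre a\<close>, which is removed.\<close>
  define V where "V = {b \<in> topspace blowup_top. ?m b \<in> {..<1}} \<inter>
    {b \<in> topspace blowup_top. snd b y \<in> ball 0 1 - {fibre a}}"
  have pullM: "pull y z \<in> M" if "z \<in> M" for z
    unfolding pull_def using \<rho>_in inv_closed[OF transporter(1)[OF yo]] that by blast
  have "continuous_map mtopology euclideanreal (\<mu>\<^sub>0 \<circ> pull y)"
    using model[OF yo] unfolding blowup_model_def by blast
  from continuous_map_compose[OF continuous_map_blowup_fst this]
  have "continuous_map blowup_top euclideanreal ?m" by (simp add: o_def)
  then have "openin blowup_top V"
    unfolding V_def
    by (intro openin_Int openin_continuous_map_preimage[where Y = euclidean]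
        continuous_map_coordinate[OF yo]) auto
  moreover have "V \<noteq> {}"
  proof -
    obtain t :: 'e where t: "norm t < 1" "t \<noteq> fibre a"
    proof (cases "fibre a = 0")
      case True
      obtain b :: 'e where "b \<in> Basis" using nonempty_Basis by blast
      then have "norm ((1 / 2) *\<^sub>R b) < 1" "(1 / 2) *\<^sub>R b \<noteq> fibre a" using True by auto
      then show ?thesis using that by blast
    next
      case False
      then show ?thesis using that[of 0] by simp
    qed
    have "?m (lift y t) = 0" using \<mu>_zero_iff[OF yo y_in] by simp
    then have "lift y t \<in> V" using t yo lift_in[OF y_in, of t] by (simp add: V_def)
    then show ?thesis by blast
  qed
  moreover have "lifted g a \<notin> V" if g: "g \<in> carrier G" for g
  proof
    let ?b = "lifted g a"
    assume b: "?b \<in> V"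
    then have bp: "?b \<in> points" and mb: "?m ?b < 1" and nb: "norm (snd ?b y) < 1" "snd ?b y \<noteq> fibre a"
      by (auto simp: V_def)
    show False
    proof (cases "fst ?b = y")
      case True
      then have "fibre ?b = snd ?b y" using yo by (simp add: fibre_def)
      then show False using nb(2) fibre_lifted[OF g a] by simp
    next
      case False
      let ?z = "pull y (fst ?b)"
      have zM: "?z \<in> M" using pullM fst_in[OF bp] by blast
      have "\<mu>\<^sub>0 ?z \<noteq> 0" using \<mu>_zero_iff[OF yo fst_in[OF bp]] False by simp
      moreover have "norm (\<kappa>\<^sub>0 ?z) = \<mu>\<^sub>0 ?z" using unit[OF zM] mb by simp
      moreover have "snd ?b y = \<kappa>\<^sub>0 ?z /\<^sub>R \<mu>\<^sub>0 ?z" using coordinate_off_point[OF bp yo False] by simp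
      ultimately have "norm (snd ?b y) = 1" by (metis norm_scaleR abs_inverse abs_norm_cancel left_inverse)
      then show False using nb(1) by simp
    qed
  qed
  ultimately show thesis using that by blast
qed

text \<open>The new action is the lifted one conjugated by a homeomorphism \<open>h\<close> near the
  projection. Passing from \<open>x\<close> to the base point of \<open>h' x\<close> costs
  \<open>\<epsilon> / 2\<close> by uniform continuity, and applying \<open>h\<close> instead of the
  projection afterwards costs another \<open>\<epsilon> / 2\<close>.\<close>

theorem exists_nearby_nonconjugate_action:
  assumes dense: "has_dense_orbit G mtopology \<rho>" and F: "finite F" "F \<subseteq> carrier G" and \<epsilon>: "\<epsilon> > 0"
  shows "\<exists>\<rho>'\<in>C0_actions G mtopology. \<not> C0_conjugate G mtopology \<rho>' \<rho> \<and>
    (\<forall>g\<in>F. \<forall>x\<in>M. d (\<rho> g x) (\<rho>' g x) < \<epsilon>)"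
proof -
  have "\<exists>\<delta>>0. \<forall>x\<in>M. \<forall>z\<in>M. d z x < \<delta> \<longrightarrow> d (\<rho> g z) (\<rho> g x) < \<epsilon> / 2" if "g \<in> carrier G" for g
  proof -
    have "uniformly_continuous_map (metric (M, d)) (metric (M, d)) (\<rho> g)"
      using continuous_eq_uniformly_continuous_map[of "metric (M, d)" "metric (M, d)"]
        compact_M continuous[OF that] by simp
    then have "\<forall>\<epsilon>>0. \<exists>\<delta>>0. \<forall>x\<in>M. \<forall>z\<in>M. d z x < \<delta> \<longrightarrow> d (\<rho> g z) (\<rho> g x) < \<epsilon>"
      by (simp add: uniformly_continuous_map_def)
    then show ?thesis using half_gt_zero[OF \<epsilon>] by blast
  qed
  then have "\<forall>g\<in>F. \<exists>\<delta>>0. \<forall>x\<in>M. \<forall>z\<in>M. d z x < \<delta> \<longrightarrow> d (\<rho> g z) (\<rho> g x) < \<epsilon> / 2"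
    using F(2) by blast
  from bchoice[OF this] obtain e where e: "\<And>g. g \<in> F \<Longrightarrow> e g > 0"
    "\<And>g x z. g \<in> F \<Longrightarrow> x \<in> M \<Longrightarrow> z \<in> M \<Longrightarrow> d z x < e g \<Longrightarrow> d (\<rho> g z) (\<rho> g x) < \<epsilon> / 2"
    by blast
  \<comment> \<open>Small enough for both halves of the estimate: as an error of \<open>h\<close>
    itself and as an input error for each \<open>\<rho> g\<close> with \<open>g\<close> in
    \<open>F\<close>.\<close>
  define \<delta> where "\<delta> = Min (insert (\<epsilon> / 2) (e ` F))"
  have "finite (insert (\<epsilon> / 2) (e ` F))" using F(1) by simp
  then have \<delta>: "\<delta> > 0" "\<delta> \<le> \<epsilon> / 2" "\<And>g. g \<in> F \<Longrightarrow> \<delta> \<le> e g"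
    unfolding \<delta>_def using e(1) \<epsilon> by (simp, intro Min_le, auto)
  obtain h where h: "homeomorphic_map blowup_top mtopology h"
    "\<And>a. a \<in> points \<Longrightarrow> d (fst a) (h a) < \<delta>"
    using homeomorphic_near_projection[OF \<delta>(1)] by blast
  then obtain h' where hh: "homeomorphic_maps blowup_top mtopology h h'"
    using homeomorphic_map_maps by blast
  then have conth: "continuous_map blowup_top mtopology h"
    and conth': "continuous_map mtopology blowup_top h'"
    and h'h: "\<And>a. a \<in> points \<Longrightarrow> h' (h a) = a" and hh': "\<And>x. x \<in> M \<Longrightarrow> h (h' x) = x"
    by (auto simp: homeomorphic_maps_def)
  have hM: "h a \<in> M" if "a \<in> points" for a
    using continuous_map_image_subset_topspace[OF conth] that by auto
  have h'M: "h' x \<in> points" if "x \<in> M" for x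
    using continuous_map_image_subset_topspace[OF conth'] that by auto
  define f where "f g x = h (lifted g (h' x))" for g x
  define \<rho>' where "\<rho>' = (\<lambda>g\<in>carrier G. restrict (f g) (topspace mtopology))"
  have \<rho>'_eq: "\<rho>' g x = h (lifted g (h' x))" if "g \<in> carrier G" "x \<in> M" for g x
    using that by (simp add: \<rho>'_def f_def)
  have "\<rho>' \<in> C0_actions G mtopology"
    unfolding \<rho>'_def
  proof (rule C0_actionsI)
    show "continuous_map mtopology mtopology (f g)" if "g \<in> carrier G" for g
      using continuous_map_compose[OF continuous_map_compose[OF conth' continuous_map_lifted[OF that]] conth]
      by (simp add: o_def f_def[abs_def])
  qed (use is_group hh' h'M h'h lifted_one lifted_mult in \<open>simp_all add: f_def\<close>)
  moreover have "d (\<rho> g x) (\<rho>' g x) < \<epsilon>" if g: "g \<in> F" and x: "x \<in> M" for g x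
  proof -
    let ?a = "h' x"
    have gG: "g \<in> carrier G" using g F(2) by blast
    have a: "?a \<in> points" "fst ?a \<in> M" using h'M[OF x] fst_in by auto
    have "d (fst ?a) x < e g" using h(2)[OF a(1)] hh'[OF x] \<delta>(3)[OF g] by simp
    then have 1: "d (\<rho> g x) (\<rho> g (fst ?a)) < \<epsilon> / 2"
      using e(2)[OF g x a(2)] commute by simp
    have 2: "d (\<rho> g (fst ?a)) (\<rho>' g x) < \<epsilon> / 2"
      using h(2)[OF lifted_in[OF gG a(1)]] \<delta>(2) \<rho>'_eq[OF gG x] by simp
    have "d (\<rho> g x) (\<rho>' g x) \<le> d (\<rho> g x) (\<rho> g (fst ?a)) + d (\<rho> g (fst ?a)) (\<rho>' g x)"
      using \<rho>_in[OF gG] x a \<rho>'_eq[OF gG x] hM lifted_in[OF gG a(1)] by (intro triangle) auto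
    then show ?thesis using 1 2 by simp
  qed
  moreover have "\<not> C0_conjugate G mtopology \<rho>' \<rho>"
  proof
    assume "C0_conjugate G mtopology \<rho>' \<rho>"
    then obtain k where k: "homeomorphic_map mtopology mtopology k"
      "\<And>g x. g \<in> carrier G \<Longrightarrow> x \<in> M \<Longrightarrow> k (\<rho>' g x) = \<rho> g (k x)"
      by (auto simp: C0_conjugate_def Homeo_def)
    have kim: "k ` M = M" using homeomorphic_imp_surjective_map[OF k(1)] by simp
    have kinj: "inj_on k M" using homeomorphic_imp_injective_map[OF k(1)] by simp
    obtain x0 where x0: "x0 \<in> M" "mtopology closure_of (orbit G \<rho> x0) = M"
      using dense by (auto simp: has_dense_orbit_def)
    \<comment> \<open>A conjugacy \<open>k\<close> carries the \<open>\<rho>'\<close>-orbit of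
      \<open>x\<close> onto the dense orbit of \<open>x0\<close>, yet the image under
      \<open>k\<close> and \<open>h\<close> of the open set \<open>V\<close> is open, nonempty and
      missed by it.\<close>
    obtain x where x: "x \<in> M" "k x = x0" using x0(1) kim by (metis imageE)
    obtain V where V: "openin blowup_top V" "V \<noteq> {}" "\<And>g. g \<in> carrier G \<Longrightarrow> lifted g (h' x) \<notin> V"
      using lifted_orbit_misses[OF h'M[OF x(1)]] by blast
    have VP: "V \<subseteq> points" using openin_subset[OF V(1)] by simp
    have "open_map blowup_top mtopology h" "open_map mtopology mtopology k"
      using h(1) k(1) homeomorphic_imp_open_map by blast+
    moreover define W where "W = k ` (h ` V)"
    ultimately have op: "openin mtopology W" using V(1) by (simp add: open_map_def)
    obtain b where b: "b \<in> V" using V(2) by blast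
    then have "k (h b) \<in> W" by (simp add: W_def)
    moreover have "k (h b) \<in> mtopology closure_of (orbit G \<rho> x0)"
      using subsetD[OF openin_subset[OF op] calculation] x0(2) by simp
    ultimately obtain w where w: "w \<in> orbit G \<rho> x0" "w \<in> W"
      using op unfolding in_closure_of by blast
    obtain g where g: "g \<in> carrier G" "w = \<rho> g x0" using w(1) by (auto simp: orbit_def)
    obtain c where c: "c \<in> V" "w = k (h c)" using w(2) by (auto simp: W_def)
    have lp: "lifted g (h' x) \<in> points" using lifted_in[OF g(1) h'M[OF x(1)]] .
    have "k (h c) = k (h (lifted g (h' x)))"
      using k(2)[OF g(1) x(1)] \<rho>'_eq[OF g(1) x(1)] x(2) g(2) c(2) by simp
    then have "h c = h (lifted g (h' x))"
      using inj_onD[OF kinj] hM lp c(1) VP by blast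
    then have "c = lifted g (h' x)"
      using h'h[OF lp] h'h[OF subsetD[OF VP c(1)]] by simp
    then show False using V(3)[OF g(1)] c(1) by blast
  qed
  ultimately show ?thesis by blast
qed

end

section \<open>The Baire category argument and the assembly of the theorem\<close>

text \<open>The bad points for one \<open>g\<close> form the frontier of its closed fixed point set,
  which is closed with empty interior; countably many such sets cannot cover a nonempty compact
  Hausdorff space.\<close>

lemma generic_trivial_fixed_germs:
  assumes comp: "compact_space T" and haus: "Hausdorff_space T" and ne: "topspace T \<noteq> {}"
    and I: "countable I" and cont: "\<And>g. g \<in> I \<Longrightarrow> continuous_map T T (f g)"
  obtains y where "y \<in> topspace T"
    "\<And>g. g \<in> I \<Longrightarrow> f g y = y \<Longrightarrow> \<exists>U. openin T U \<and> y \<in> U \<and> (\<forall>z\<in>U. f g z = z)"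
proof -
  define Fix where "Fix g = {z \<in> topspace T. f g z = z}" for g
  define B where "B g = Fix g - T interior_of Fix g" for g
  have closed_B: "closedin T (B g)" if "g \<in> I" for g
    unfolding B_def Fix_def
    using closedin_continuous_maps_eq[OF haus cont[OF that] continuous_map_id[unfolded id_def]]
    by (intro closedin_diff openin_interior_of) auto
  have "T interior_of B g = {}" for g
  proof -
    have "T interior_of B g \<subseteq> T interior_of Fix g"
      by (rule interior_of_mono) (auto simp: B_def)
    moreover have "T interior_of B g \<subseteq> B g" by (rule interior_of_subset)
    ultimately show ?thesis by (auto simp: B_def)
  qed
  moreover have "locally_compact_space T" "regular_space T"
    using comp haus compact_imp_locally_compact_space compact_Hausdorff_imp_regular_space by blast+
  ultimately have "T interior_of \<Union>(B ` I) = {}"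
    using I closed_B by (intro Baire_category_alt) auto
  then have "\<not> topspace T \<subseteq> \<Union>(B ` I)"
    using ne by (metis interior_of_maximal_eq openin_topspace subset_empty)
  then obtain y where y: "y \<in> topspace T" "\<And>g. g \<in> I \<Longrightarrow> y \<notin> B g" by blast
  show thesis
  proof (rule that[OF y(1)])
    fix g assume g: "g \<in> I" "f g y = y"
    then have "y \<in> T interior_of Fix g" using y by (auto simp: B_def Fix_def)
    then show "\<exists>U. openin T U \<and> y \<in> U \<and> (\<forall>z\<in>U. f g z = z)"
      using openin_interior_of[of T "Fix g"] interior_of_subset[of T "Fix g"]
      by (intro exI[of _ "T interior_of Fix g"]) (auto simp: Fix_def)
  qed
qed

theorem mainTheorem3:
  fixes M :: "'m topology"
    and A :: "('m, 'e::euclidean_space) chart set"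
    and G :: "('g, 'b) monoid_scheme"
    and \<rho>\<^sub>0 :: "'g \<Rightarrow> 'm \<Rightarrow> 'm"
  assumes "smooth_manifold M A"
    and "compact_space M"
    and "group G"
    and "countable (carrier G)"
    and "\<rho>\<^sub>0 \<in> C1_actions G M A"
    and "has_dense_orbit G M \<rho>\<^sub>0"
  shows "(\<exists>\<rho>\<in>C0_actions G M. \<not> C0_conjugate G M \<rho> \<rho>\<^sub>0) \<and>
    (\<forall>W. openin (action_topology G M) W \<and> \<rho>\<^sub>0 \<in> W \<longrightarrow>
      (\<exists>\<rho>\<in>W. \<not> C0_conjugate G M \<rho> \<rho>\<^sub>0))"
proof -
  have haus: "Hausdorff_space M" and "second_countable M"
    and charts: "\<And>c. c \<in> A \<Longrightarrow> is_chart M c" "(\<Union>c\<in>A. fst c) = topspace M"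
    using assms(1) by (auto simp: smooth_manifold_def)
  then have "metrizable_space M"
    using assms(2) compact_Hausdorff_second_countable_imp_metrizable by blast
  then obtain X d where X: "Metric_space X d" and M: "M = Metric_space.mtopology X d"
    unfolding metrizable_space_def by blast
  interpret Metric_space X d by fact
  have \<rho>: "\<rho>\<^sub>0 \<in> C0_actions G M" using assms(5) by (simp add: C1_actions_def)
  then have act: "group_action G X \<rho>\<^sub>0" and E: "\<rho>\<^sub>0 \<in> carrier G \<rightarrow>\<^sub>E Homeo M"
    by (auto simp: C0_actions_def M)
  have cont: "continuous_map M M (\<rho>\<^sub>0 g)" if "g \<in> carrier G" for g
    using PiE_mem[OF E that] homeomorphic_imp_continuous_map unfolding Homeo_def by blast
  have ne: "topspace M \<noteq> {}" using assms(6) by (auto simp: has_dense_orbit_def)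
  obtain y where y: "y \<in> topspace M" "\<And>g. g \<in> carrier G \<Longrightarrow> \<rho>\<^sub>0 g y = y \<Longrightarrow>
      \<exists>U. openin M U \<and> y \<in> U \<and> (\<forall>z\<in>U. \<rho>\<^sub>0 g z = z)"
    by (rule generic_trivial_fixed_germs[of M "carrier G" \<rho>\<^sub>0])
      (use assms(2,4) haus ne cont in blast)+
  obtain c where c: "c \<in> A" "y \<in> fst c" using charts(2) y(1) by blast
  obtain U \<phi> where U: "c = (U, \<phi>)" by fastforce
  have chart: "openin M U" "y \<in> U" "open (\<phi> ` U)"
      "homeomorphic_map (subtopology M U) (top_of_set (\<phi> ` U)) \<phi>"
    using charts(1)[OF c(1)] c(2) by (auto simp: is_chart_def U)
  obtain \<mu> and \<kappa> :: "'m \<Rightarrow> 'e" where \<mu>\<kappa>: "blowup_model M y \<mu> \<kappa>"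
    "\<And>z. z \<in> topspace M \<Longrightarrow> \<mu> z \<le> 1 \<Longrightarrow> norm (\<kappa> z) = \<mu> z"
    using chart_imp_blowup_model[OF haus chart] by blast
  interpret action_blowup X d G \<rho>\<^sub>0 y \<mu> \<kappa>
    unfolding action_blowup_def action_blowup_axioms_def
    using X act assms(2,4) cont \<mu>\<kappa> y(2) unfolding M topspace_mtopology by blast
  have near: "\<exists>\<rho>\<in>W. \<not> C0_conjugate G M \<rho> \<rho>\<^sub>0"
    if W: "openin (action_topology G M) W" "\<rho>\<^sub>0 \<in> W" for W
  proof -
    obtain F \<epsilon> where F: "finite F" "F \<subseteq> carrier G" "\<epsilon> > 0"
      "\<And>\<rho>'. \<rho>' \<in> C0_actions G mtopology \<Longrightarrow> (\<forall>g\<in>F. \<forall>x\<in>X. d (\<rho>\<^sub>0 g x) (\<rho>' g x) < \<epsilon>) \<Longrightarrow> \<rho>' \<in> W"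
      using action_topology_nbhd[OF W[unfolded M]] by blast
    then show ?thesis
      using exists_nearby_nonconjugate_action[OF assms(6)[unfolded M] F(1-3)] unfolding M by blast
  qed
  \<comment> \<open>Bare existence is the special case in which the neighbourhood is the whole space
    of actions.\<close>
  moreover have "openin (action_topology G M) (C0_actions G M)"
    using openin_topspace[of "action_topology G M"] by (simp add: topspace_action_topology)
  ultimately show ?thesis using \<rho> by blast
qed

end
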